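(* Let $\mathcal{C}$ be a stiff symmetric monoidal category. There is a bijective correspondence between localisable monads on $\mathcal{C}$ and formal monads on $\overline{\mathcal{C}}$ in the 2-category $[\mathrm{ZI}(\mathcal{C})^{\mathrm{op}},\mathbf{Cat}]$. In one direction, a localisable monad $(T,\eta,\mu,\mathrm{st})$ is sent to the formal monad whose components are the monads $(T|_u,\eta|_u,\mu|_u)$ on $\mathcal{C}|_u$; in the other direction, a formal monad $(T_u,\eta_u,\mu_u)_{u}$ is sent to the monad $T_1$ on $\mathcal{C}|_1\cong\mathcal{C}$ equipped with the strength $\mathrm{st}_{A,U}=\varepsilon_{T_1 F G A}\circ F T_u \eta_{GA}\colon T_1(A)\otimes U=FGT_1A=FT_uGA\to FGT_1FGA\to T_1FGA=T_1(A\otimes U)$, where $F=\mathcal{C}\|_{u\leq 1}$, $G=\mathcal{C}|_{u\leq 1}$ and $\eta,\varepsilon$ are the unit and counit of $F\dashv G$.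
   Context: Let $\mathcal{C}$ be a symmetric monoidal category with unit $I$, unitors $\lambda,\rho$, associator $\alpha$ and symmetry $\sigma$ (coherence isomorphisms are often suppressed). A central idempotent is a morphism $u\colon U\to I$ such that $\rho_U\circ(U\otimes u)=\lambda_U\circ(u\otimes U)\colon U\otimes U\to U$ and this morphism is invertible; $u$ and $v\colon V\to I$ are identified when $u=v\circ m$ for an isomorphism $m$. $\mathrm{ZI}(\mathcal{C})$ is the meet-semilattice of central idempotents, with $u\leq v$ iff $u=v\circ m$ for some morphism $m\colon U\to V$, meet $u\otimes v$ and top $1=\mathrm{id}_I$, regarded as a poset category. For a central idempotent $u$, $\mathcal{C}|_u$ is the symmetric monoidal category with the objects of $\mathcal{C}$, morphisms $A\to B$ being morphisms $A\otimes U\to B$ of $\mathcal{C}$, composition of $f\colon A\otimes U\to B$ and $g\colon B\otimes U\to C$ given by $g\circ(f\otimes U)\circ(A\otimes U\otimes u)^{-1}$, identity $A\otimes u$, tensor of objects as in $\mathcal{C}$, and tensor of $f\colon A\otimes U\to B$, $f'\colon A'\otimes U\to B'$ given by $(f\otimes f')\circ(A\otimes\sigma_{A',U}\otimes U)\circ(A\otimes A'\otimes U\otimes u)^{-1}$. For $u\leq v$ with $u=v\circ m$, the functor $\mathcal{C}|_{u\leq v}\colon\mathcal{C}|_v\to\mathcal{C}|_u$ is $A\mapsto A$, $f\mapsto f\circ(A\otimes m)$, and $\mathcal{C}\|_{u\leq v}\colon\mathcal{C}|_u\to\mathcal{C}|_v$ is $A\mapsto A\otimes U$, $f\mapsto (f\otimes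 U)\circ(A\otimes u\otimes U)^{-1}\circ(A\otimes U\otimes v)$; one has $\mathcal{C}\|_{u\leq v}\dashv\mathcal{C}|_{u\leq v}$. $\mathcal{C}$ is stiff when for every object $A$ and central idempotents $u,v$ the square with vertices $A\otimes U\otimes V$, $A\otimes V$, $A\otimes U$, $A$ and edges induced by $u,v$ (bottom $A\otimes u$, right $A\otimes v$) is a pullback. A monad $(T,\eta,\mu)$ on $\mathcal{C}$ is localisable when there are morphisms $\mathrm{st}_{A,U}\colon T(A)\otimes U\to T(A\otimes U)$ for each object $A$ and central idempotent $u\colon U\to I$ with: $T(\rho_A)\circ\mathrm{st}_{A,I}=\rho_{T(A)}$; $T(\alpha_{A,U,V})\circ\mathrm{st}_{A,U\otimes V}=\mathrm{st}_{A\otimes U,V}\circ(\mathrm{st}_{A,U}\otimes V)\circ\alpha_{TA,U,V}$; $\eta_{A\otimes U}=\mathrm{st}_{A,U}\circ(\eta_A\otimes U)$; $\mu_{A\otimes U}\circ T(\mathrm{st}_{A,U})\circ\mathrm{st}_{T(A),U}=\mathrm{st}_{A,U}\circ(\mu_A\otimes U)$; $\mathrm{st}_{A,V}\circ(T(A)\otimes m)=T(A\otimes m)\circ\mathrm{st}_{A,U}$ whenever $u=v\circ m$; and $\mathrm{st}_{B,U}\circ(T(f)\otimes U)=T(f\otimes U)\circ\mathrm{st}_{A,U}$ for all $f\colon A\to B$. For such $T$ and central idempotent $u$, $T|_u$ is the monad on $\mathcal{C}|_u$ with $T|_u(A)=T(A)$, $T|_u(f\colon A\otimes U\to B)=T(f)\circ\mathrm{st}_{A,U}$,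 $(\eta|_u)_A=\eta_A\otimes u$, $(\mu|_u)_A=\mu_A\otimes u$. $\overline{\mathcal{C}}\colon\mathrm{ZI}(\mathcal{C})^{\mathrm{op}}\to\mathbf{Cat}$ sends $u$ to $\mathcal{C}|_u$ and $u\leq v$ to $\mathcal{C}|_{u\leq v}$. The 2-category $[\mathrm{ZI}(\mathcal{C})^{\mathrm{op}},\mathbf{Cat}]$ has functors as 0-cells, natural transformations as 1-cells and modifications as 2-cells. A formal monad on $\overline{\mathcal{C}}$ amounts to: a monad $(T_u,\eta_u,\mu_u)$ on $\mathcal{C}|_u$ for every central idempotent $u$, such that for all $u\leq v$: $T_u\circ\mathcal{C}|_{u\leq v}=\mathcal{C}|_{u\leq v}\circ T_v$ as functors (in particular $T_u(A)=T_v(A)$), $(\eta_u)_{\mathcal{C}|_{u\leq v}A}=\mathcal{C}|_{u\leq v}((\eta_v)_A)$ and $(\mu_u)_{\mathcal{C}|_{u\leq v}A}=\mathcal{C}|_{u\leq v}((\mu_v)_A)$. *)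

theory Defs
  imports Main "HOL-Library.FuncSet"
begin

record ('o, 'a) cat =
  Ob :: "'o set"
  Ar :: "'a set"
  Dom :: "'a \<Rightarrow> 'o"
  Cod :: "'a \<Rightarrow> 'o"
  idn :: "'o \<Rightarrow> 'a"
  cmp :: "'a \<Rightarrow> 'a \<Rightarrow> 'a" (infixr "\<cdot>\<index>" 55)

definition hom :: "('o, 'a, 'm) cat_scheme \<Rightarrow> 'o \<Rightarrow> 'o \<Rightarrow> 'a set" where
  "hom C A B = {f \<in> Ar C. Dom C f = A \<and> Cod C f = B}"

locale category =
  fixes C :: "('o, 'a, 'm) cat_scheme" (structure)
  assumes Dom_in: "f \<in> Ar C \<Longrightarrow> Dom C f \<in> Ob C"
    and Cod_in: "f \<in> Ar C \<Longrightarrow> Cod C f \<in> Ob C"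
    and idn_hom: "A \<in> Ob C \<Longrightarrow> idn C A \<in> hom C A A"
    and cmp_hom: "f \<in> hom C A B \<Longrightarrow> g \<in> hom C B D \<Longrightarrow> g \<cdot> f \<in> hom C A D"
    and idn_left: "f \<in> hom C A B \<Longrightarrow> idn C B \<cdot> f = f"
    and idn_right: "f \<in> hom C A B \<Longrightarrow> f \<cdot> idn C A = f"
    and cmp_assoc: "f \<in> hom C A B \<Longrightarrow> g \<in> hom C B D \<Longrightarrow> h \<in> hom C D E
      \<Longrightarrow> h \<cdot> (g \<cdot> f) = (h \<cdot> g) \<cdot> f"

definition inverse_arrows :: "('o, 'a, 'm) cat_scheme \<Rightarrow> 'a \<Rightarrow> 'a \<Rightarrow> bool" where
  "inverse_arrows C f g \<longleftrightarrow> f \<in> Ar C \<and> g \<in> hom C (Cod C f) (Dom C f)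
     \<and> cmp C g f = idn C (Dom C f) \<and> cmp C f g = idn C (Cod C f)"

definition is_iso :: "('o, 'a, 'm) cat_scheme \<Rightarrow> 'a \<Rightarrow> bool" where
  "is_iso C f \<longleftrightarrow> (\<exists>g. inverse_arrows C f g)"

definition inv_ar :: "('o, 'a, 'm) cat_scheme \<Rightarrow> 'a \<Rightarrow> 'a" where
  "inv_ar C f = (THE g. inverse_arrows C f g)"

definition is_pullback :: "('o, 'a, 'm) cat_scheme \<Rightarrow> 'a \<Rightarrow> 'a \<Rightarrow> 'a \<Rightarrow> 'a \<Rightarrow> bool" where
  "is_pullback C p q f g \<longleftrightarrow>
     {p, q, f, g} \<subseteq> Ar C \<and> Dom C p = Dom C q \<and> Cod C p = Dom C f \<and> Cod C q = Dom C g
     \<and> Cod C f = Cod C g \<and> cmp C f p = cmp C g q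
     \<and> (\<forall>W\<in>Ob C. \<forall>h\<in>hom C W (Dom C f). \<forall>k\<in>hom C W (Dom C g). cmp C f h = cmp C g k
          \<longrightarrow> (\<exists>!l. l \<in> hom C W (Dom C p) \<and> cmp C p l = h \<and> cmp C q l = k))"

text \<open>Functors and transformations are extensional on their carriers, so that HOL equality
  is the intended equality and sets of such structures may be put in bijection.\<close>

record ('o, 'a, 'p, 'b) cfunctor =
  on_ob :: "'o \<Rightarrow> 'p"
  on_ar :: "'a \<Rightarrow> 'b"

definition is_functor ::
  "('o, 'a, 'm) cat_scheme \<Rightarrow> ('p, 'b, 'n) cat_scheme \<Rightarrow> ('o, 'a, 'p, 'b) cfunctor \<Rightarrow> bool" where
  "is_functor C D F \<longleftrightarrow>
     on_ob F \<in> Ob C \<rightarrow>\<^sub>E Ob D \<and> on_ar F \<in> Ar C \<rightarrow>\<^sub>E Ar D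
     \<and> (\<forall>f\<in>Ar C. Dom D (on_ar F f) = on_ob F (Dom C f) \<and> Cod D (on_ar F f) = on_ob F (Cod C f))
     \<and> (\<forall>A\<in>Ob C. on_ar F (idn C A) = idn D (on_ob F A))
     \<and> (\<forall>f\<in>Ar C. \<forall>g\<in>Ar C. Cod C f = Dom C g
          \<longrightarrow> on_ar F (cmp C g f) = cmp D (on_ar F g) (on_ar F f))"

definition id_functor :: "('o, 'a, 'm) cat_scheme \<Rightarrow> ('o, 'a, 'o, 'a) cfunctor" where
  "id_functor C = \<lparr>on_ob = (\<lambda>A\<in>Ob C. A), on_ar = (\<lambda>f\<in>Ar C. f)\<rparr>"

definition functor_comp :: "('o, 'a, 'm) cat_scheme \<Rightarrow> ('p, 'b, 'q, 'c) cfunctor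
    \<Rightarrow> ('o, 'a, 'p, 'b) cfunctor \<Rightarrow> ('o, 'a, 'q, 'c) cfunctor" where
  "functor_comp C G F = \<lparr>on_ob = compose (Ob C) (on_ob G) (on_ob F),
                         on_ar = compose (Ar C) (on_ar G) (on_ar F)\<rparr>"

definition nat_trans :: "('o, 'a, 'm) cat_scheme \<Rightarrow> ('p, 'b, 'n) cat_scheme
    \<Rightarrow> ('o, 'a, 'p, 'b) cfunctor \<Rightarrow> ('o, 'a, 'p, 'b) cfunctor \<Rightarrow> ('o \<Rightarrow> 'b) \<Rightarrow> bool" where
  "nat_trans C D F G t \<longleftrightarrow>
     t \<in> extensional (Ob C)
     \<and> (\<forall>A\<in>Ob C. t A \<in> hom D (on_ob F A) (on_ob G A))
     \<and> (\<forall>f\<in>Ar C. cmp D (t (Cod C f)) (on_ar F f) = cmp D (on_ar G f) (t (Dom C f)))"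

record ('o, 'a) monad =
  endo :: "('o, 'a, 'o, 'a) cfunctor"
  eta :: "'o \<Rightarrow> 'a"
  mu :: "'o \<Rightarrow> 'a"

definition monad_laws :: "('o, 'a, 'm) cat_scheme \<Rightarrow> ('o, 'a, 'n) monad_scheme \<Rightarrow> bool" where
  "monad_laws C T \<longleftrightarrow> (\<forall>A\<in>Ob C.
     cmp C (mu T A) (eta T (on_ob (endo T) A)) = idn C (on_ob (endo T) A)
     \<and> cmp C (mu T A) (on_ar (endo T) (eta T A)) = idn C (on_ob (endo T) A)
     \<and> cmp C (mu T A) (mu T (on_ob (endo T) A)) = cmp C (mu T A) (on_ar (endo T) (mu T A)))"

definition is_monad :: "('o, 'a, 'm) cat_scheme \<Rightarrow> ('o, 'a, 'n) monad_scheme \<Rightarrow> bool" where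
  "is_monad C T \<longleftrightarrow>
     is_functor C C (endo T)
     \<and> nat_trans C C (id_functor C) (endo T) (eta T)
     \<and> nat_trans C C (functor_comp C (endo T) (endo T)) (endo T) (mu T)
     \<and> monad_laws C T"

text \<open>A contravariant functor from the preorder \<open>(Idx, Le)\<close> to Cat; \<open>Res u v\<close>, for \<open>Le u v\<close>,
  is the functor from the fibre at \<open>v\<close> to the fibre at \<open>u\<close>.\<close>

record ('i, 'o, 'a) diagram =
  Idx :: "'i set"
  Le :: "'i \<Rightarrow> 'i \<Rightarrow> bool"
  Fib :: "'i \<Rightarrow> ('o, 'a) cat"
  Res :: "'i \<Rightarrow> 'i \<Rightarrow> ('o, 'a, 'o, 'a) cfunctor"

text \<open>Endo-1-cells (natural transformations) on \<open>X\<close>, and 2-cells (modifications) between them.\<close>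

definition one_cell :: "('i, 'o, 'a) diagram \<Rightarrow> ('i \<Rightarrow> ('o, 'a, 'o, 'a) cfunctor) \<Rightarrow> bool" where
  "one_cell X \<theta> \<longleftrightarrow>
     (\<forall>u\<in>Idx X. is_functor (Fib X u) (Fib X u) (\<theta> u))
     \<and> (\<forall>u\<in>Idx X. \<forall>v\<in>Idx X. Le X u v \<longrightarrow>
          functor_comp (Fib X v) (\<theta> u) (Res X u v) = functor_comp (Fib X v) (Res X u v) (\<theta> v))"

definition two_cell :: "('i, 'o, 'a) diagram \<Rightarrow> ('i \<Rightarrow> ('o, 'a, 'o, 'a) cfunctor)
    \<Rightarrow> ('i \<Rightarrow> ('o, 'a, 'o, 'a) cfunctor) \<Rightarrow> ('i \<Rightarrow> 'o \<Rightarrow> 'a) \<Rightarrow> bool" where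
  "two_cell X \<theta> \<theta>' t \<longleftrightarrow>
     (\<forall>u\<in>Idx X. nat_trans (Fib X u) (Fib X u) (\<theta> u) (\<theta>' u) (t u))
     \<and> (\<forall>u\<in>Idx X. \<forall>v\<in>Idx X. Le X u v \<longrightarrow>
          (\<forall>A\<in>Ob (Fib X v). t u (on_ob (Res X u v) A) = on_ar (Res X u v) (t v A)))"

text \<open>The monad laws are equations between 2-cells, hence hold componentwise.\<close>

definition formal_monad :: "('i, 'o, 'a) diagram \<Rightarrow> ('i \<Rightarrow> ('o, 'a) monad) \<Rightarrow> bool" where
  "formal_monad X M \<longleftrightarrow>
     M \<in> extensional (Idx X)
     \<and> one_cell X (\<lambda>u. endo (M u))
     \<and> two_cell X (\<lambda>u. id_functor (Fib X u)) (\<lambda>u. endo (M u)) (\<lambda>u. eta (M u))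
     \<and> two_cell X (\<lambda>u. functor_comp (Fib X u) (endo (M u)) (endo (M u))) (\<lambda>u. endo (M u))
         (\<lambda>u. mu (M u))
     \<and> (\<forall>u\<in>Idx X. monad_laws (Fib X u) (M u))"

text \<open>The associator points from \<open>A \<otimes> (B \<otimes> D)\<close> to \<open>(A \<otimes> B) \<otimes> D\<close>; \<open>\<otimes>\<close> is the tensor of
  objects and \<open>\<boxtimes>\<close> that of arrows.\<close>

record ('o, 'a) smc = "('o, 'a) cat" +
  tens :: "'o \<Rightarrow> 'o \<Rightarrow> 'o" (infixl "\<otimes>\<index>" 70)
  tensa :: "'a \<Rightarrow> 'a \<Rightarrow> 'a" (infixl "\<boxtimes>\<index>" 70)
  uni :: "'o" ("\<one>\<index>")
  assoc :: "'o \<Rightarrow> 'o \<Rightarrow> 'o \<Rightarrow> 'a"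
  lunit :: "'o \<Rightarrow> 'a"
  runit :: "'o \<Rightarrow> 'a"
  symm :: "'o \<Rightarrow> 'o \<Rightarrow> 'a"

locale symmetric_monoidal_category = category C
  for C :: "('o, 'a) smc" (structure) +
  assumes uni_in: "\<one> \<in> Ob C"
    and tens_in: "A \<in> Ob C \<Longrightarrow> B \<in> Ob C \<Longrightarrow> A \<otimes> B \<in> Ob C"
    and tensa_hom: "f \<in> hom C A B \<Longrightarrow> f' \<in> hom C A' B' \<Longrightarrow> f \<boxtimes> f' \<in> hom C (A \<otimes> A') (B \<otimes> B')"
    and tensa_idn: "A \<in> Ob C \<Longrightarrow> B \<in> Ob C \<Longrightarrow> idn C A \<boxtimes> idn C B = idn C (A \<otimes> B)"
    and interchange: "f \<in> hom C A B \<Longrightarrow> g \<in> hom C B D \<Longrightarrow> f' \<in> hom C A' B' \<Longrightarrow> g' \<in> hom C B' D'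
      \<Longrightarrow> (g \<cdot> f) \<boxtimes> (g' \<cdot> f') = (g \<boxtimes> g') \<cdot> (f \<boxtimes> f')"
    and assoc_hom: "A \<in> Ob C \<Longrightarrow> B \<in> Ob C \<Longrightarrow> D \<in> Ob C
      \<Longrightarrow> assoc C A B D \<in> hom C (A \<otimes> (B \<otimes> D)) ((A \<otimes> B) \<otimes> D)"
    and assoc_iso: "A \<in> Ob C \<Longrightarrow> B \<in> Ob C \<Longrightarrow> D \<in> Ob C \<Longrightarrow> is_iso C (assoc C A B D)"
    and assoc_nat: "f \<in> hom C A A' \<Longrightarrow> g \<in> hom C B B' \<Longrightarrow> h \<in> hom C D D'
      \<Longrightarrow> assoc C A' B' D' \<cdot> (f \<boxtimes> (g \<boxtimes> h)) = ((f \<boxtimes> g) \<boxtimes> h) \<cdot> assoc C A B D"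
    and lunit_hom: "A \<in> Ob C \<Longrightarrow> lunit C A \<in> hom C (\<one> \<otimes> A) A"
    and lunit_iso: "A \<in> Ob C \<Longrightarrow> is_iso C (lunit C A)"
    and lunit_nat: "f \<in> hom C A B \<Longrightarrow> lunit C B \<cdot> (idn C \<one> \<boxtimes> f) = f \<cdot> lunit C A"
    and runit_hom: "A \<in> Ob C \<Longrightarrow> runit C A \<in> hom C (A \<otimes> \<one>) A"
    and runit_iso: "A \<in> Ob C \<Longrightarrow> is_iso C (runit C A)"
    and runit_nat: "f \<in> hom C A B \<Longrightarrow> runit C B \<cdot> (f \<boxtimes> idn C \<one>) = f \<cdot> runit C A"
    and symm_hom: "A \<in> Ob C \<Longrightarrow> B \<in> Ob C \<Longrightarrow> symm C A B \<in> hom C (A \<otimes> B) (B \<otimes> A)"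
    and symm_nat: "f \<in> hom C A A' \<Longrightarrow> g \<in> hom C B B'
      \<Longrightarrow> symm C A' B' \<cdot> (f \<boxtimes> g) = (g \<boxtimes> f) \<cdot> symm C A B"
    and symm_inv: "A \<in> Ob C \<Longrightarrow> B \<in> Ob C \<Longrightarrow> symm C B A \<cdot> symm C A B = idn C (A \<otimes> B)"
    and pentagon: "A \<in> Ob C \<Longrightarrow> B \<in> Ob C \<Longrightarrow> D \<in> Ob C \<Longrightarrow> E \<in> Ob C
      \<Longrightarrow> assoc C (A \<otimes> B) D E \<cdot> assoc C A B (D \<otimes> E)
        = (assoc C A B D \<boxtimes> idn C E) \<cdot> assoc C A (B \<otimes> D) E \<cdot> (idn C A \<boxtimes> assoc C B D E)"
    and triangle: "A \<in> Ob C \<Longrightarrow> B \<in> Ob C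
      \<Longrightarrow> (runit C A \<boxtimes> idn C B) \<cdot> assoc C A \<one> B = idn C A \<boxtimes> lunit C B"
    and hexagon: "A \<in> Ob C \<Longrightarrow> B \<in> Ob C \<Longrightarrow> D \<in> Ob C
      \<Longrightarrow> assoc C D A B \<cdot> symm C (A \<otimes> B) D \<cdot> assoc C A B D
        = (symm C A D \<boxtimes> idn C B) \<cdot> assoc C A D B \<cdot> (idn C A \<boxtimes> symm C B D)"

definition central_idempotents :: "('o, 'a) smc \<Rightarrow> 'a set" where
  "central_idempotents C = {u \<in> Ar C. Cod C u = uni C
     \<and> cmp C (runit C (Dom C u)) (tensa C (idn C (Dom C u)) u)
       = cmp C (lunit C (Dom C u)) (tensa C u (idn C (Dom C u)))
     \<and> is_iso C (cmp C (runit C (Dom C u)) (tensa C (idn C (Dom C u)) u))}"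

definition idem_le :: "('o, 'a) smc \<Rightarrow> 'a \<Rightarrow> 'a \<Rightarrow> bool" where
  "idem_le C u v \<longleftrightarrow> (\<exists>m\<in>hom C (Dom C u) (Dom C v). u = cmp C v m)"

definition idem_eq :: "('o, 'a) smc \<Rightarrow> 'a \<Rightarrow> 'a \<Rightarrow> bool" where
  "idem_eq C u v \<longleftrightarrow> (\<exists>m\<in>hom C (Dom C u) (Dom C v). is_iso C m \<and> u = cmp C v m)"

text \<open>The mediating arrow is unique in a stiff category, where central idempotents are monic.\<close>

definition idem_arr :: "('o, 'a) smc \<Rightarrow> 'a \<Rightarrow> 'a \<Rightarrow> 'a" where
  "idem_arr C u v = (THE m. m \<in> hom C (Dom C u) (Dom C v) \<and> u = cmp C v m)"

text \<open>The elements of the semilattice ZI(C) are central idempotents up to \<^const>\<open>idem_eq\<close>.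
  It is presented by one representative of each class; the top is represented by the identity.
  With the order \<^const>\<open>idem_le\<close> this is a poset.\<close>

definition is_ZI :: "('o, 'a) smc \<Rightarrow> 'a set \<Rightarrow> bool" where
  "is_ZI C Z \<longleftrightarrow> Z \<subseteq> central_idempotents C \<and> idn C (uni C) \<in> Z
     \<and> (\<forall>u\<in>central_idempotents C. \<exists>!z. z \<in> Z \<and> idem_eq C u z)"

definition idem_rep :: "('o, 'a) smc \<Rightarrow> 'a set \<Rightarrow> 'a \<Rightarrow> 'a" where
  "idem_rep C Z u = (THE z. z \<in> Z \<and> idem_eq C u z)"

definition idem_tens :: "('o, 'a) smc \<Rightarrow> 'a \<Rightarrow> 'a \<Rightarrow> 'a" where
  "idem_tens C u v = cmp C (lunit C (uni C)) (tensa C u v)"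

text \<open>For \<open>f : A \<rightarrow> B\<close> and \<open>u : U \<rightarrow> I\<close>, the arrow \<open>f \<otimes> u : A \<otimes> U \<rightarrow> B\<close> (unitor suppressed).\<close>

definition tens_idem :: "('o, 'a) smc \<Rightarrow> 'a \<Rightarrow> 'a \<Rightarrow> 'a" where
  "tens_idem C f u = cmp C (runit C (Cod C f)) (tensa C f u)"

abbreviation proj :: "('o, 'a) smc \<Rightarrow> 'o \<Rightarrow> 'a \<Rightarrow> 'a" where
  "proj C A u \<equiv> tens_idem C (idn C A) u"

locale stiff_category = symmetric_monoidal_category C for C :: "('o, 'a) smc" (structure) +
  assumes stiff: "A \<in> Ob C \<Longrightarrow> u \<in> central_idempotents C \<Longrightarrow> v \<in> central_idempotents C
    \<Longrightarrow> is_pullback C (proj C (A \<otimes> Dom C u) v) (proj C A u \<boxtimes> idn C (Dom C v))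
                       (proj C A u) (proj C A v)"

text \<open>An arrow \<open>A \<rightarrow> B\<close> of \<open>C|\<^sub>u\<close> is the pair of its domain \<open>A\<close> and an arrow \<open>A \<otimes> U \<rightarrow> B\<close> of \<open>C\<close>;
  the latter need not determine \<open>A\<close>.\<close>

definition restr_cat :: "('o, 'a) smc \<Rightarrow> 'a \<Rightarrow> ('o, 'o \<times> 'a) cat" where
  "restr_cat C u = \<lparr>
     Ob = Ob C,
     Ar = {(A, f). A \<in> Ob C \<and> f \<in> Ar C \<and> Dom C f = tens C A (Dom C u)},
     Dom = fst,
     Cod = (\<lambda>(A, f). Cod C f),
     idn = (\<lambda>A. (A, proj C A u)),
     cmp = (\<lambda>(B, g) (A, f). (A, cmp C g (cmp C (tensa C f (idn C (Dom C u)))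
              (inv_ar C (proj C (tens C A (Dom C u)) u)))))\<rparr>"

definition restr_functor ::
  "('o, 'a) smc \<Rightarrow> 'a \<Rightarrow> 'a \<Rightarrow> ('o, 'o \<times> 'a, 'o, 'o \<times> 'a) cfunctor" where
  "restr_functor C u v = \<lparr>
     on_ob = (\<lambda>A\<in>Ob C. A),
     on_ar = restrict (\<lambda>(A, f). (A, cmp C f (tensa C (idn C A) (idem_arr C u v))))
               (Ar (restr_cat C v))\<rparr>"

definition ext_functor ::
  "('o, 'a) smc \<Rightarrow> 'a \<Rightarrow> 'a \<Rightarrow> ('o, 'o \<times> 'a, 'o, 'o \<times> 'a) cfunctor" where
  "ext_functor C u v = \<lparr>
     on_ob = (\<lambda>A\<in>Ob C. tens C A (Dom C u)),
     on_ar = restrict (\<lambda>(A, f). (tens C A (Dom C u),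
                 cmp C (tensa C f (idn C (Dom C u)))
                  (cmp C (inv_ar C (tensa C (proj C A u) (idn C (Dom C u))))
                    (proj C (tens C A (Dom C u)) v))))
               (Ar (restr_cat C u))\<rparr>"

text \<open>The adjunction \<open>ext_functor C u v \<stileturn> restr_functor C u v\<close> is given by the bijection
  \<open>C(A \<otimes> U, B) \<cong> C((A \<otimes> U) \<otimes> V, B)\<close> of precomposition with the isomorphism \<open>A \<otimes> U \<otimes> v\<close>.
  Its unit at \<open>A\<close> is the transpose of the identity of \<open>A \<otimes> U\<close> in \<open>C|\<^sub>v\<close>, and its counit at \<open>B\<close>
  that of the identity \<open>B \<otimes> u\<close> of \<open>B\<close> in \<open>C|\<^sub>u\<close>.\<close>

definition adj_unit :: "('o, 'a) smc \<Rightarrow> 'a \<Rightarrow> 'a \<Rightarrow> 'o \<Rightarrow> 'o \<times> 'a" where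
  "adj_unit C u v A = (A, idn C (tens C A (Dom C u)))"

definition adj_counit :: "('o, 'a) smc \<Rightarrow> 'a \<Rightarrow> 'a \<Rightarrow> 'o \<Rightarrow> 'o \<times> 'a" where
  "adj_counit C u v B = (tens C B (Dom C u), cmp C (proj C B u) (proj C (tens C B (Dom C u)) v))"

definition Cbar :: "('o, 'a) smc \<Rightarrow> 'a set \<Rightarrow> ('a, 'o, 'o \<times> 'a) diagram" where
  "Cbar C Z = \<lparr>Idx = Z, Le = idem_le C, Fib = restr_cat C, Res = restr_functor C\<rparr>"

text \<open>The isomorphism \<open>C|\<^sub>1 \<cong> C\<close> (identity on objects), on arrows in both directions.\<close>

definition from_top :: "('o, 'a) smc \<Rightarrow> 'o \<times> 'a \<Rightarrow> 'a" where
  "from_top C = (\<lambda>(A, f). cmp C f (inv_ar C (runit C A)))"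

definition to_top :: "('o, 'a) smc \<Rightarrow> 'a \<Rightarrow> 'o \<times> 'a" where
  "to_top C f = (Dom C f, cmp C f (runit C (Dom C f)))"

text \<open>The strength \<open>st A u : T A \<otimes> U \<rightarrow> T (A \<otimes> U)\<close> is given at every central idempotent \<open>u\<close>, not
  only at one representative per class, since its axioms refer to \<open>u \<otimes> v\<close>.\<close>

record ('o, 'a) lmonad = "('o, 'a) monad" +
  st :: "'o \<Rightarrow> 'a \<Rightarrow> 'a"

definition localisable_monad :: "('o, 'a) smc \<Rightarrow> ('o, 'a) lmonad \<Rightarrow> bool" where
  "localisable_monad C L \<longleftrightarrow>
    (let T = on_ob (endo L); Ta = on_ar (endo L); Z = central_idempotents C in
     is_monad C L
     \<and> st L \<in> extensional (Ob C) \<and> (\<forall>A\<in>Ob C. st L A \<in> extensional Z)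
     \<and> (\<forall>A\<in>Ob C. \<forall>u\<in>Z. st L A u \<in> hom C (tens C (T A) (Dom C u)) (T (tens C A (Dom C u))))
     \<and> (\<forall>A\<in>Ob C. cmp C (Ta (runit C A)) (st L A (idn C (uni C))) = runit C (T A))
     \<and> (\<forall>A\<in>Ob C. \<forall>u\<in>Z. \<forall>v\<in>Z.
          cmp C (Ta (assoc C A (Dom C u) (Dom C v))) (st L A (idem_tens C u v))
          = cmp C (st L (tens C A (Dom C u)) v)
              (cmp C (tensa C (st L A u) (idn C (Dom C v))) (assoc C (T A) (Dom C u) (Dom C v))))
     \<and> (\<forall>A\<in>Ob C. \<forall>u\<in>Z.
          eta L (tens C A (Dom C u)) = cmp C (st L A u) (tensa C (eta L A) (idn C (Dom C u))))
     \<and> (\<forall>A\<in>Ob C. \<forall>u\<in>Z.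
          cmp C (mu L (tens C A (Dom C u))) (cmp C (Ta (st L A u)) (st L (T A) u))
          = cmp C (st L A u) (tensa C (mu L A) (idn C (Dom C u))))
     \<and> (\<forall>A\<in>Ob C. \<forall>u\<in>Z. \<forall>v\<in>Z. \<forall>m\<in>hom C (Dom C u) (Dom C v). u = cmp C v m \<longrightarrow>
          cmp C (st L A v) (tensa C (idn C (T A)) m) = cmp C (Ta (tensa C (idn C A) m)) (st L A u))
     \<and> (\<forall>f\<in>Ar C. \<forall>u\<in>Z.
          cmp C (st L (Cod C f) u) (tensa C (Ta f) (idn C (Dom C u)))
          = cmp C (Ta (tensa C f (idn C (Dom C u)))) (st L (Dom C f) u)))"

definition restr_monad :: "('o, 'a) smc \<Rightarrow> ('o, 'a) lmonad \<Rightarrow> 'a \<Rightarrow> ('o, 'o \<times> 'a) monad" where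
  "restr_monad C L u =
    (let T = on_ob (endo L) in
     \<lparr>endo = \<lparr>on_ob = (\<lambda>A\<in>Ob C. T A),
              on_ar = restrict (\<lambda>(A, f). (T A, cmp C (on_ar (endo L) f) (st L A u)))
                        (Ar (restr_cat C u))\<rparr>,
      eta = (\<lambda>A\<in>Ob C. (A, tens_idem C (eta L A) u)),
      mu = (\<lambda>A\<in>Ob C. (T (T A), tens_idem C (mu L A) u))\<rparr>)"

definition formal_of_local ::
  "('o, 'a) smc \<Rightarrow> 'a set \<Rightarrow> ('o, 'a) lmonad \<Rightarrow> 'a \<Rightarrow> ('o, 'o \<times> 'a) monad" where
  "formal_of_local C Z L = (\<lambda>u\<in>Z. restr_monad C L u)"

text \<open>The strength \<open>\<epsilon> \<circ> F (T\<^sub>u \<eta>)\<close>, a composite in \<open>C|\<^sub>1\<close>, transported to \<open>C\<close>.\<close>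

definition formal_strength ::
  "('o, 'a) smc \<Rightarrow> ('a \<Rightarrow> ('o, 'o \<times> 'a) monad) \<Rightarrow> 'o \<Rightarrow> 'a \<Rightarrow> 'a" where
  "formal_strength C M A u =
    (let i = idn C (uni C); F = ext_functor C u i; G = restr_functor C u i in
     from_top C
       (cmp (restr_cat C i)
         (adj_counit C u i (on_ob (endo (M i)) (on_ob F (on_ob G A))))
         (on_ar F (on_ar (endo (M u)) (adj_unit C u i (on_ob G A))))))"

definition top_functor ::
  "('o, 'a) smc \<Rightarrow> ('a \<Rightarrow> ('o, 'o \<times> 'a) monad) \<Rightarrow> ('o, 'a, 'o, 'a) cfunctor" where
  "top_functor C M =
    (let T = endo (M (idn C (uni C))) in
     \<lparr>on_ob = (\<lambda>A\<in>Ob C. on_ob T A),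
      on_ar = (\<lambda>f\<in>Ar C. from_top C (on_ar T (to_top C f)))\<rparr>)"

text \<open>For a central idempotent \<open>u\<close> whose chosen representative is \<open>z\<close>, with \<open>u = z \<circ> m\<close> and \<open>m\<close>
  invertible, the strength at \<open>u\<close> is that at \<open>z\<close> transported along \<open>m\<close>.\<close>

definition local_of_formal ::
  "('o, 'a) smc \<Rightarrow> 'a set \<Rightarrow> ('a \<Rightarrow> ('o, 'o \<times> 'a) monad) \<Rightarrow> ('o, 'a) lmonad" where
  "local_of_formal C Z M =
    (let i = idn C (uni C); T = top_functor C M in
     \<lparr>endo = T,
      eta = (\<lambda>A\<in>Ob C. from_top C (eta (M i) A)),
      mu = (\<lambda>A\<in>Ob C. from_top C (mu (M i) A)),
      st = (\<lambda>A\<in>Ob C. \<lambda>u\<in>central_idempotents C.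
        (let z = idem_rep C Z u; m = idem_arr C u z in
         cmp C (inv_ar C (on_ar T (tensa C (idn C A) m)))
           (cmp C (formal_strength C M A z) (tensa C (idn C (on_ob T A)) m))))\<rparr>)"

end

theory Submission
  imports Defs
begin

text \<open>Write \<open>p\<^sub>A : A \<otimes> U \<rightarrow> A\<close> for \<open>A \<otimes> u\<close>. Centrality says that \<open>p\<close> at \<open>A \<otimes> U\<close> is \<open>p\<^sub>A \<otimes> U\<close>, and stiffness
  makes \<open>p\<^sub>A\<close> monic. An arrow \<open>f : A \<otimes> U \<rightarrow> B\<close> of \<open>C|\<^sub>u\<close> is the composite of the restriction
  \<open>f \<circ> p\<close> of an arrow of \<open>C\<close> with the unit \<open>id : A \<rightarrow> A \<otimes> U\<close> of the adjunction. Since a formal monad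
  acts on restricted arrows as its component at the top does, it is determined by that
  component together with the images \<open>st\<^sub>A\<^sub>,\<^sub>U\<close> of the units under \<open>T\<^sub>u\<close>, and \<open>T\<^sub>u f = T f \<circ> st\<close>. The axioms of
  a strength are then functoriality and naturality at the units. Conversely functoriality of
  \<open>f \<mapsto> T f \<circ> st\<close> comes down to \<open>T p \<circ> st = p\<close>. Associativity of the strength is automatic, because
  the associator at \<open>u \<otimes> v\<close> factors through the inverse of \<open>p\<close> at \<open>A \<otimes> (U \<otimes> V)\<close>.\<close>

section \<open>Functors, monads and formal monads evaluated on their carriers\<close>

lemma is_functorD:
  assumes "is_functor C D F"
  shows "on_ob F \<in> extensional (Ob C)" "on_ar F \<in> extensional (Ar C)"
    "A \<in> Ob C \<Longrightarrow> on_ob F A \<in> Ob D"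
    "f \<in> Ar C \<Longrightarrow> on_ar F f \<in> Ar D"
    "f \<in> Ar C \<Longrightarrow> Dom D (on_ar F f) = on_ob F (Dom C f)"
    "f \<in> Ar C \<Longrightarrow> Cod D (on_ar F f) = on_ob F (Cod C f)"
    "A \<in> Ob C \<Longrightarrow> on_ar F (idn C A) = idn D (on_ob F A)"
    "f \<in> Ar C \<Longrightarrow> g \<in> Ar C \<Longrightarrow> Cod C f = Dom C g
      \<Longrightarrow> on_ar F (cmp C g f) = cmp D (on_ar F g) (on_ar F f)"
  using assms by (auto simp: is_functor_def PiE_iff)

text \<open>The identity and composite functors are restricted to the carriers. All conditions
  quantify over those carriers, so the restrictions evaluate away and plain naturality equations
  remain.\<close>

lemma is_monad_iff:
  "is_monad C T \<longleftrightarrow> is_functor C C (endo T)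
    \<and> eta T \<in> extensional (Ob C) \<and> mu T \<in> extensional (Ob C)
    \<and> (\<forall>A\<in>Ob C. eta T A \<in> hom C A (on_ob (endo T) A)
      \<and> mu T A \<in> hom C (on_ob (endo T) (on_ob (endo T) A)) (on_ob (endo T) A))
    \<and> (\<forall>f\<in>Ar C. cmp C (eta T (Cod C f)) f = cmp C (on_ar (endo T) f) (eta T (Dom C f))
      \<and> cmp C (mu T (Cod C f)) (on_ar (endo T) (on_ar (endo T) f))
        = cmp C (on_ar (endo T) f) (mu T (Dom C f)))
    \<and> monad_laws C T"
  by (auto simp: is_monad_def nat_trans_def id_functor_def functor_comp_def compose_def)

lemma is_monadD:
  assumes "is_monad C T"
  shows "is_functor C C (endo T)" "eta T \<in> extensional (Ob C)" "mu T \<in> extensional (Ob C)"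
  using assms by (simp_all add: is_monad_def nat_trans_def)

lemma restr_cat_simps [simp]:
  "Ob (restr_cat C u) = Ob C"
  "(A, f) \<in> Ar (restr_cat C u) \<longleftrightarrow> A \<in> Ob C \<and> f \<in> Ar C \<and> Dom C f = tens C A (Dom C u)"
  "Dom (restr_cat C u) (A, f) = A"
  "Cod (restr_cat C u) (A, f) = Cod C f"
  "idn (restr_cat C u) A = (A, proj C A u)"
  "cmp (restr_cat C u) (B, g) (A, f) = (A, cmp C g (cmp C (tensa C f (idn C (Dom C u)))
    (inv_ar C (proj C (tens C A (Dom C u)) u))))"
  by (simp_all add: restr_cat_def)

lemma restr_functor_simps [simp]:
  "A \<in> Ob C \<Longrightarrow> on_ob (restr_functor C u v) A = A"
  "A \<in> Ob C \<Longrightarrow> f \<in> Ar C \<Longrightarrow> Dom C f = tens C A (Dom C v)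
    \<Longrightarrow> on_ar (restr_functor C u v) (A, f) = (A, cmp C f (tensa C (idn C A) (idem_arr C u v)))"
  by (simp_all add: restr_functor_def)

text \<open>Composites are extensional, so they agree once they agree on carriers. Functoriality of
  \<open>F\<close> keeps \<open>on_ob F A\<close> among the objects, where restriction acts as the
  identity.\<close>

lemma functor_comp_restr_functor_iff:
  assumes "is_functor (restr_cat C v) (restr_cat C v) F"
  shows "functor_comp (restr_cat C v) G (restr_functor C u v)
      = functor_comp (restr_cat C v) (restr_functor C u v) F
    \<longleftrightarrow> (\<forall>A\<in>Ob C. on_ob G A = on_ob F A)
      \<and> (\<forall>x\<in>Ar (restr_cat C v). on_ar G (on_ar (restr_functor C u v) x)
          = on_ar (restr_functor C u v) (on_ar F x))"
    (is "_ \<longleftrightarrow> ?ob \<and> ?ar")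
proof -
  have *: "compose S a b = compose S c d \<longleftrightarrow> (\<forall>x\<in>S. a (b x) = c (d x))" for S :: "'s set" and a b c d
    by (auto simp: compose_def fun_eq_iff restrict_def)
  have "on_ob F A \<in> Ob C" if "A \<in> Ob C" for A
    using is_functorD(3)[OF assms] that by simp
  then show ?thesis
    by (simp add: functor_comp_def *)
qed

text \<open>Restriction is the identity on objects, so the conditions on 1-cells and 2-cells reduce
  to a monad in each fibre plus equations along each \<open>idem_le C u v\<close>. Both directions
  of the correspondence work with this form.\<close>

lemma formal_monad_Cbar_iff:
  "formal_monad (Cbar C Z) M \<longleftrightarrow> M \<in> extensional Z \<and> (\<forall>u\<in>Z. is_monad (restr_cat C u) (M u))
    \<and> (\<forall>u\<in>Z. \<forall>v\<in>Z. idem_le C u v \<longrightarrow>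
        (\<forall>A\<in>Ob C. on_ob (endo (M u)) A = on_ob (endo (M v)) A
          \<and> eta (M u) A = on_ar (restr_functor C u v) (eta (M v) A)
          \<and> mu (M u) A = on_ar (restr_functor C u v) (mu (M v) A))
        \<and> (\<forall>x\<in>Ar (restr_cat C v). on_ar (endo (M u)) (on_ar (restr_functor C u v) x)
          = on_ar (restr_functor C u v) (on_ar (endo (M v)) x)))"
  (is "_ \<longleftrightarrow> _ \<and> ?m \<and> ?r")
proof -
  have 1: "one_cell (Cbar C Z) (\<lambda>u. endo (M u)) \<longleftrightarrow>
    (\<forall>u\<in>Z. is_functor (restr_cat C u) (restr_cat C u) (endo (M u)))
    \<and> (\<forall>u\<in>Z. \<forall>v\<in>Z. idem_le C u v \<longrightarrow>
        (\<forall>A\<in>Ob C. on_ob (endo (M u)) A = on_ob (endo (M v)) A)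
        \<and> (\<forall>x\<in>Ar (restr_cat C v). on_ar (endo (M u)) (on_ar (restr_functor C u v) x)
          = on_ar (restr_functor C u v) (on_ar (endo (M v)) x)))"
    by (simp add: one_cell_def Cbar_def functor_comp_restr_functor_iff cong: conj_cong ball_cong)
  have 2: "two_cell (Cbar C Z) F G t \<longleftrightarrow>
    (\<forall>u\<in>Z. nat_trans (restr_cat C u) (restr_cat C u) (F u) (G u) (t u))
    \<and> (\<forall>u\<in>Z. \<forall>v\<in>Z. idem_le C u v \<longrightarrow> (\<forall>A\<in>Ob C. t u A = on_ar (restr_functor C u v) (t v A)))"
    for F G t
    by (auto simp: two_cell_def Cbar_def)
  show ?thesis
    unfolding formal_monad_def 1 2 is_monad_def by (simp add: Cbar_def) blast
qed

section \<open>Composition and isomorphisms in a category\<close>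

context category
begin

lemma idn_ar [simp]:
  assumes "A \<in> Ob C"
  shows "idn C A \<in> Ar C" "Dom C (idn C A) = A" "Cod C (idn C A) = A"
  using idn_hom[OF assms] by (auto simp: hom_def)

lemma cmp_ar [simp]:
  assumes "f \<in> Ar C" "g \<in> Ar C" "Cod C f = Dom C g"
  shows "g \<cdot> f \<in> Ar C" "Dom C (g \<cdot> f) = Dom C f" "Cod C (g \<cdot> f) = Cod C g"
  using cmp_hom[of f "Dom C f" "Cod C f" g "Cod C g"] assms by (auto simp: hom_def)

declare Dom_in [simp] Cod_in [simp]

lemma cmp_idn [simp]:
  assumes "f \<in> Ar C"
  shows "Cod C f = B \<Longrightarrow> idn C B \<cdot> f = f" "Dom C f = A \<Longrightarrow> f \<cdot> idn C A = f"
  using assms idn_left[of f "Dom C f" "Cod C f"] idn_right[of f "Dom C f" "Cod C f"]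
  by (auto simp: hom_def)

text \<open>Oriented so that the simplifier nests composites to the right. Where an equation
  concerns an inner pair of factors, later proofs rebracket by hand to expose that pair.\<close>

lemma cmp_assoc_right [simp]:
  assumes "f \<in> Ar C" "g \<in> Ar C" "h \<in> Ar C" "Cod C f = Dom C g" "Cod C g = Dom C h"
  shows "(h \<cdot> g) \<cdot> f = h \<cdot> (g \<cdot> f)"
  using cmp_assoc[of f "Dom C f" "Cod C f" g "Cod C g" h "Cod C h"] assms by (auto simp: hom_def)

lemma is_isoI:
  assumes "f \<in> Ar C" "g \<in> Ar C" "Dom C g = Cod C f" "Cod C g = Dom C f"
    "g \<cdot> f = idn C (Dom C f)" "f \<cdot> g = idn C (Cod C f)"
  shows "is_iso C f"
  using assms by (auto simp: is_iso_def inverse_arrows_def hom_def)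

lemma inverse_arrows_inv_ar:
  assumes "is_iso C f"
  shows "inverse_arrows C f (inv_ar C f)"
  unfolding inv_ar_def
proof (rule theI')
  obtain g where g: "inverse_arrows C f g"
    using assms by (auto simp: is_iso_def)
  moreover have "h = g" if "inverse_arrows C f h" for h
  proof -
    have "h = h \<cdot> (f \<cdot> g)"
      using that g by (auto simp: inverse_arrows_def hom_def)
    also have "\<dots> = (h \<cdot> f) \<cdot> g"
      using that g by (intro cmp_assoc_right[symmetric]) (auto simp: inverse_arrows_def hom_def)
    also have "\<dots> = g"
      using that g by (auto simp: inverse_arrows_def hom_def)
    finally show ?thesis .
  qed
  ultimately show "\<exists>!g. inverse_arrows C f g"
    by blast
qed

lemma is_iso_ar: "is_iso C f \<Longrightarrow> f \<in> Ar C"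
  by (auto simp: is_iso_def inverse_arrows_def)

lemma inv_ar [simp]:
  assumes "is_iso C f"
  shows "inv_ar C f \<in> Ar C" "Dom C (inv_ar C f) = Cod C f" "Cod C (inv_ar C f) = Dom C f"
    "inv_ar C f \<cdot> f = idn C (Dom C f)" "f \<cdot> inv_ar C f = idn C (Cod C f)"
  using inverse_arrows_inv_ar[OF assms] by (auto simp: inverse_arrows_def hom_def)

text \<open>The form of the inverse laws that still matches when a right-nested composite continues
  after the cancelling pair.\<close>

lemma inv_ar_cancel [simp]:
  assumes "is_iso C f" "g \<in> Ar C"
  shows "Cod C g = Dom C f \<Longrightarrow> inv_ar C f \<cdot> (f \<cdot> g) = g"
    "Cod C g = Cod C f \<Longrightarrow> f \<cdot> (inv_ar C f \<cdot> g) = g"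
  using assms by (simp_all add: is_iso_ar flip: cmp_assoc_right)

lemma iso_monic:
  assumes "is_iso C e" "f \<in> Ar C" "g \<in> Ar C" "Cod C f = Dom C e" "Cod C g = Dom C e" "e \<cdot> f = e \<cdot> g"
  shows "f = g"
  by (metis assms inv_ar_cancel(1))

lemma iso_epic:
  assumes "is_iso C e" "f \<in> Ar C" "g \<in> Ar C" "Dom C f = Cod C e" "Dom C g = Cod C e" "f \<cdot> e = g \<cdot> e"
  shows "f = g"
proof -
  have "(f \<cdot> e) \<cdot> inv_ar C e = (g \<cdot> e) \<cdot> inv_ar C e"
    using assms by simp
  then show ?thesis
    using assms(1-5) is_iso_ar[OF assms(1)] by simp
qed

lemma is_iso_idn [simp]: "A \<in> Ob C \<Longrightarrow> is_iso C (idn C A)"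
  by (rule is_isoI[of _ "idn C A"]) auto

lemma is_iso_inv_ar [simp]: "is_iso C f \<Longrightarrow> is_iso C (inv_ar C f)"
  by (rule is_isoI[of _ f]) (auto intro: is_iso_ar)

lemma is_iso_cmp [simp]:
  assumes "is_iso C f" "is_iso C g" "Cod C f = Dom C g"
  shows "is_iso C (g \<cdot> f)"
  using assms assms(1,2)[THEN is_iso_ar] by (intro is_isoI[of _ "inv_ar C f \<cdot> inv_ar C g"]) auto

lemma inv_ar_eqI:
  assumes "is_iso C f" "g \<in> Ar C" "Cod C g = Dom C f" "f \<cdot> g = idn C (Cod C f)" "Dom C g = Cod C f"
  shows "inv_ar C f = g"
  by (rule iso_monic[OF assms(1)]) (use assms in simp_all)

lemma inv_ar_idn [simp]: "A \<in> Ob C \<Longrightarrow> inv_ar C (idn C A) = idn C A"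
  by (rule inv_ar_eqI) auto

lemma functor_is_iso:
  assumes F: "is_functor C C F" and f: "is_iso C f"
  shows "is_iso C (on_ar F f)"
proof (rule is_isoI)
  note Fs = is_functorD[OF F]
  let ?g = "inv_ar C f"
  have f': "f \<in> Ar C"
    using f by (rule is_iso_ar)
  show "on_ar F ?g \<cdot> on_ar F f = idn C (Dom C (on_ar F f))"
    "on_ar F f \<cdot> on_ar F ?g = idn C (Cod C (on_ar F f))"
    using f f' by (simp_all add: Fs flip: Fs(8))
qed (use f is_iso_ar[OF f] is_functorD[OF F] in auto)

end

section \<open>Coherence and central idempotents\<close>

context symmetric_monoidal_category
begin

declare uni_in [simp] tens_in [simp] tensa_idn [simp] assoc_iso [simp] lunit_iso [simp] runit_iso [simp]

lemma tensa_ar [simp]: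
  assumes "f \<in> Ar C" "g \<in> Ar C"
  shows "f \<boxtimes> g \<in> Ar C" "Dom C (f \<boxtimes> g) = Dom C f \<otimes> Dom C g" "Cod C (f \<boxtimes> g) = Cod C f \<otimes> Cod C g"
  using tensa_hom[of f "Dom C f" "Cod C f" g "Dom C g" "Cod C g"] assms by (auto simp: hom_def)

lemma assoc_ar [simp]:
  assumes "A \<in> Ob C" "B \<in> Ob C" "D \<in> Ob C"
  shows "assoc C A B D \<in> Ar C" "Dom C (assoc C A B D) = A \<otimes> (B \<otimes> D)"
    "Cod C (assoc C A B D) = (A \<otimes> B) \<otimes> D"
  using assoc_hom[OF assms] by (auto simp: hom_def)

lemma unit_ar [simp]:
  assumes "A \<in> Ob C"
  shows "lunit C A \<in> Ar C" "Dom C (lunit C A) = \<one> \<otimes> A" "Cod C (lunit C A) = A"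
    "runit C A \<in> Ar C" "Dom C (runit C A) = A \<otimes> \<one>" "Cod C (runit C A) = A"
  using lunit_hom[OF assms] runit_hom[OF assms] by (auto simp: hom_def)

lemma symm_ar [simp]:
  assumes "A \<in> Ob C" "B \<in> Ob C"
  shows "symm C A B \<in> Ar C" "Dom C (symm C A B) = A \<otimes> B" "Cod C (symm C A B) = B \<otimes> A"
  using symm_hom[OF assms] by (auto simp: hom_def)

lemma is_iso_symm [simp]: "A \<in> Ob C \<Longrightarrow> B \<in> Ob C \<Longrightarrow> is_iso C (symm C A B)"
  by (rule is_isoI[of _ "symm C B A"]) (auto simp: symm_inv)

lemma tensa_cmp [simp]:
  assumes "f \<in> Ar C" "g \<in> Ar C" "Cod C f = Dom C g" "f' \<in> Ar C" "g' \<in> Ar C" "Cod C f' = Dom C g'"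
  shows "(g \<boxtimes> g') \<cdot> (f \<boxtimes> f') = (g \<cdot> f) \<boxtimes> (g' \<cdot> f')"
  using interchange[of f "Dom C f" "Cod C f" g "Cod C g" f' "Dom C f'" "Cod C f'" g' "Cod C g'"] assms
  by (auto simp: hom_def)

text \<open>Interchange in front of a further factor, as right-nested normal forms require.\<close>

lemma tensa_cmp_cmp [simp]:
  assumes "f \<in> Ar C" "g \<in> Ar C" "Cod C f = Dom C g" "f' \<in> Ar C" "g' \<in> Ar C" "Cod C f' = Dom C g'"
    "h \<in> Ar C" "Cod C h = Dom C f \<otimes> Dom C f'"
  shows "(g \<boxtimes> g') \<cdot> ((f \<boxtimes> f') \<cdot> h) = ((g \<cdot> f) \<boxtimes> (g' \<cdot> f')) \<cdot> h"
  using assms cmp_assoc_right[of h "f \<boxtimes> f'" "g \<boxtimes> g'"] by (simp del: cmp_assoc_right)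

lemma is_iso_tensa [simp]:
  assumes "is_iso C f" "is_iso C g"
  shows "is_iso C (f \<boxtimes> g)"
  using assms assms(1,2)[THEN is_iso_ar] by (intro is_isoI[of _ "inv_ar C f \<boxtimes> inv_ar C g"]) auto

lemma assoc_natural:
  assumes "f \<in> Ar C" "g \<in> Ar C" "h \<in> Ar C"
  shows "assoc C (Cod C f) (Cod C g) (Cod C h) \<cdot> (f \<boxtimes> (g \<boxtimes> h))
    = ((f \<boxtimes> g) \<boxtimes> h) \<cdot> assoc C (Dom C f) (Dom C g) (Dom C h)"
  using assms by (intro assoc_nat) (auto simp: hom_def)

lemma lunit_natural:
  "f \<in> Ar C \<Longrightarrow> lunit C (Cod C f) \<cdot> (idn C \<one> \<boxtimes> f) = f \<cdot> lunit C (Dom C f)"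
  by (intro lunit_nat) (auto simp: hom_def)

lemma runit_natural:
  "f \<in> Ar C \<Longrightarrow> runit C (Cod C f) \<cdot> (f \<boxtimes> idn C \<one>) = f \<cdot> runit C (Dom C f)"
  by (intro runit_nat) (auto simp: hom_def)

text \<open>The right unitor is a natural isomorphism from tensoring with the unit to the identity
  functor, so tensoring with the unit reflects equality. The coherence laws below are proved after
  such a tensoring.\<close>

lemma tensa_unit_faithful:
  assumes "f \<in> Ar C" "g \<in> Ar C" "Dom C f = Dom C g" "Cod C f = Cod C g" "f \<boxtimes> idn C \<one> = g \<boxtimes> idn C \<one>"
  shows "f = g"
proof (rule iso_epic)
  show "f \<cdot> runit C (Dom C f) = g \<cdot> runit C (Dom C f)"
    using runit_natural[OF assms(1)] runit_natural[OF assms(2)] assms(3-5) by metis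
qed (use assms in simp_all)

lemma unit_tensa_faithful:
  assumes "f \<in> Ar C" "g \<in> Ar C" "Dom C f = Dom C g" "Cod C f = Cod C g" "idn C \<one> \<boxtimes> f = idn C \<one> \<boxtimes> g"
  shows "f = g"
proof (rule iso_epic)
  show "f \<cdot> lunit C (Dom C f) = g \<cdot> lunit C (Dom C f)"
    using lunit_natural[OF assms(1)] lunit_natural[OF assms(2)] assms(3-5) by metis
qed (use assms in simp_all)

text \<open>Kelly's argument: tensor with the unit on the right, apply the pentagon at
  \<open>A\<close>, \<open>B\<close>, \<open>\<one>\<close>, \<open>\<one>\<close> and the triangle
  at \<open>A \<otimes> B\<close> and at \<open>B\<close>, then cancel the invertible
  \<open>?e\<close>.\<close>

lemma runit_tens:
  assumes [simp]: "A \<in> Ob C" "B \<in> Ob C"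
  shows "runit C (A \<otimes> B) \<cdot> assoc C A B \<one> = idn C A \<boxtimes> runit C B"
proof (rule tensa_unit_faithful)
  let ?e = "assoc C A (B \<otimes> \<one>) \<one> \<cdot> (idn C A \<boxtimes> assoc C B \<one> \<one>)"
  let ?r = "runit C (A \<otimes> B) \<boxtimes> idn C \<one>"
  have "((runit C (A \<otimes> B) \<cdot> assoc C A B \<one>) \<boxtimes> idn C \<one>) \<cdot> ?e
    = ?r \<cdot> ((assoc C A B \<one> \<boxtimes> idn C \<one>) \<cdot> ?e)"
    by simp
  also have "\<dots> = ?r \<cdot> (assoc C (A \<otimes> B) \<one> \<one> \<cdot> assoc C A B (\<one> \<otimes> \<one>))"
    by (simp only: pentagon assms uni_in)
  also have "\<dots> = (?r \<cdot> assoc C (A \<otimes> B) \<one> \<one>) \<cdot> assoc C A B (\<one> \<otimes> \<one>)"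
    by simp
  also have "\<dots> = (idn C (A \<otimes> B) \<boxtimes> lunit C \<one>) \<cdot> assoc C A B (\<one> \<otimes> \<one>)"
    by (simp only: triangle assms uni_in tens_in)
  also have "\<dots> = assoc C A B \<one> \<cdot> (idn C A \<boxtimes> (idn C B \<boxtimes> lunit C \<one>))"
    using assoc_natural[of "idn C A" "idn C B" "lunit C \<one>"] by simp
  also have "\<dots> = assoc C A B \<one> \<cdot> ((idn C A \<boxtimes> (runit C B \<boxtimes> idn C \<one>)) \<cdot> (idn C A \<boxtimes> assoc C B \<one> \<one>))"
    by (simp add: triangle)
  also have "\<dots> = (assoc C A B \<one> \<cdot> (idn C A \<boxtimes> (runit C B \<boxtimes> idn C \<one>))) \<cdot> (idn C A \<boxtimes> assoc C B \<one> \<one>)"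
    by (subst cmp_assoc_right) simp_all
  also have "\<dots> = ((idn C A \<boxtimes> runit C B) \<boxtimes> idn C \<one>) \<cdot> ?e"
    using assoc_natural[of "idn C A" "runit C B" "idn C \<one>"] by (simp del: tensa_idn)
  finally show "(runit C (A \<otimes> B) \<cdot> assoc C A B \<one>) \<boxtimes> idn C \<one> = (idn C A \<boxtimes> runit C B) \<boxtimes> idn C \<one>"
    by (rule iso_epic[rotated -1]) simp_all
qed simp_all

text \<open>The mirror image of \<open>runit_tens\<close>: tensor with the unit on the left and use
  the pentagon at \<open>\<one>\<close>, \<open>\<one>\<close>, \<open>A\<close>, \<open>B\<close>;
  here the associator in front is cancelled.\<close>

lemma lunit_tens:
  assumes [simp]: "A \<in> Ob C" "B \<in> Ob C"
  shows "lunit C (A \<otimes> B) = (lunit C A \<boxtimes> idn C B) \<cdot> assoc C \<one> A B"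
proof (rule unit_tensa_faithful)
  let ?r = "(runit C \<one> \<boxtimes> idn C A) \<boxtimes> idn C B"
  let ?e = "assoc C \<one> (\<one> \<otimes> A) B \<cdot> (idn C \<one> \<boxtimes> assoc C \<one> A B)"
  have "assoc C \<one> A B \<cdot> (idn C \<one> \<boxtimes> lunit C (A \<otimes> B))
    = assoc C \<one> A B \<cdot> ((runit C \<one> \<boxtimes> idn C (A \<otimes> B)) \<cdot> assoc C \<one> \<one> (A \<otimes> B))"
    by (simp only: triangle assms uni_in tens_in)
  also have "\<dots> = (assoc C \<one> A B \<cdot> (runit C \<one> \<boxtimes> idn C (A \<otimes> B))) \<cdot> assoc C \<one> \<one> (A \<otimes> B)"
    by simp
  also have "\<dots> = (?r \<cdot> assoc C (\<one> \<otimes> \<one>) A B) \<cdot> assoc C \<one> \<one> (A \<otimes> B)"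
    using assoc_natural[of "runit C \<one>" "idn C A" "idn C B"] by simp
  also have "\<dots> = ?r \<cdot> (assoc C (\<one> \<otimes> \<one>) A B \<cdot> assoc C \<one> \<one> (A \<otimes> B))"
    by simp
  also have "\<dots> = ?r \<cdot> ((assoc C \<one> \<one> A \<boxtimes> idn C B) \<cdot> ?e)"
    by (simp only: pentagon assms uni_in)
  also have "\<dots> = (((runit C \<one> \<boxtimes> idn C A) \<cdot> assoc C \<one> \<one> A) \<boxtimes> idn C B) \<cdot> ?e"
    by simp
  also have "\<dots> = ((idn C \<one> \<boxtimes> lunit C A) \<boxtimes> idn C B) \<cdot> ?e"
    by (simp only: triangle assms uni_in tens_in)
  also have "\<dots> = (((idn C \<one> \<boxtimes> lunit C A) \<boxtimes> idn C B) \<cdot> assoc C \<one> (\<one> \<otimes> A) B) \<cdot> (idn C \<one> \<boxtimes> assoc C \<one> A B)"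
    by simp
  also have "\<dots> = (assoc C \<one> A B \<cdot> (idn C \<one> \<boxtimes> (lunit C A \<boxtimes> idn C B))) \<cdot> (idn C \<one> \<boxtimes> assoc C \<one> A B)"
    using assoc_natural[of "idn C \<one>" "lunit C A" "idn C B"] by simp
  also have "\<dots> = assoc C \<one> A B \<cdot> (idn C \<one> \<boxtimes> ((lunit C A \<boxtimes> idn C B) \<cdot> assoc C \<one> A B))"
    by simp
  finally show "idn C \<one> \<boxtimes> lunit C (A \<otimes> B) = idn C \<one> \<boxtimes> ((lunit C A \<boxtimes> idn C B) \<cdot> assoc C \<one> A B)"
    by (rule iso_monic[rotated -1]) simp_all
qed simp_all

text \<open>Naturality of the left unitor at itself gives \<open>lunit C (\<one> \<otimes> \<one>) =
  idn C \<one> \<boxtimes> lunit C \<one>\<close>. Expanding the left side by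
  \<open>lunit_tens\<close> and the right side by the triangle leaves the two unitors to be
  compared.\<close>

lemma lunit_uni: "lunit C \<one> = runit C \<one>"
proof (rule tensa_unit_faithful)
  have "lunit C (\<one> \<otimes> \<one>) = idn C \<one> \<boxtimes> lunit C \<one>"
    by (rule iso_monic[of "lunit C \<one>"]) (use lunit_natural[of "lunit C \<one>"] in simp_all)
  then have "(lunit C \<one> \<boxtimes> idn C \<one>) \<cdot> assoc C \<one> \<one> \<one> = (runit C \<one> \<boxtimes> idn C \<one>) \<cdot> assoc C \<one> \<one> \<one>"
    by (simp add: lunit_tens triangle)
  then show "lunit C \<one> \<boxtimes> idn C \<one> = runit C \<one> \<boxtimes> idn C \<one>"
    by (rule iso_epic[rotated -1]) simp_all
qed simp_all

section \<open>Projections along central idempotents\<close>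

lemma proj_ar [simp]:
  assumes "A \<in> Ob C" "u \<in> Ar C" "Cod C u = \<one>"
  shows "proj C A u \<in> Ar C" "Dom C (proj C A u) = A \<otimes> Dom C u" "Cod C (proj C A u) = A"
  using assms by (simp_all add: tens_idem_def)

text \<open>Naturality of the projection in both variables at once, from interchange and naturality
  of the right unitor. With \<open>g\<close> a mediating arrow it turns the projection of the larger
  idempotent into that of the smaller.\<close>

lemma proj_tensa:
  assumes "f \<in> Ar C" "g \<in> Ar C" "u \<in> Ar C" "Cod C u = \<one>" "Cod C f = B" "Cod C g = Dom C u"
  shows "proj C B u \<cdot> (f \<boxtimes> g) = f \<cdot> proj C (Dom C f) (u \<cdot> g)"
proof -
  have "proj C B u \<cdot> (f \<boxtimes> g) = runit C B \<cdot> ((f \<boxtimes> idn C \<one>) \<cdot> (idn C (Dom C f) \<boxtimes> (u \<cdot> g)))"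
    using assms by (auto simp: tens_idem_def)
  also have "\<dots> = (runit C B \<cdot> (f \<boxtimes> idn C \<one>)) \<cdot> (idn C (Dom C f) \<boxtimes> (u \<cdot> g))"
    using assms by (subst cmp_assoc_right) auto
  also have "runit C B \<cdot> (f \<boxtimes> idn C \<one>) = f \<cdot> runit C (Dom C f)"
    using assms runit_natural[of f] by simp
  finally show ?thesis
    using assms by (simp add: tens_idem_def)
qed

lemma proj_natural:
  assumes "f \<in> Ar C" "u \<in> Ar C" "Cod C u = \<one>" "Cod C f = B"
  shows "proj C B u \<cdot> (f \<boxtimes> idn C (Dom C u)) = f \<cdot> proj C (Dom C f) u"
  using assms by (simp add: proj_tensa)

lemma lunit_tensa:
  assumes "u \<in> Ar C" "Cod C u = \<one>" "g \<in> Ar C"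
  shows "lunit C (Cod C g) \<cdot> (u \<boxtimes> g) = g \<cdot> (lunit C (Dom C g) \<cdot> (u \<boxtimes> idn C (Dom C g)))"
proof -
  have "lunit C (Cod C g) \<cdot> (u \<boxtimes> g)
    = (lunit C (Cod C g) \<cdot> (idn C \<one> \<boxtimes> g)) \<cdot> (u \<boxtimes> idn C (Dom C g))"
    using assms by simp
  also have "\<dots> = (g \<cdot> lunit C (Dom C g)) \<cdot> (u \<boxtimes> idn C (Dom C g))"
    using assms by (simp only: lunit_natural)
  finally show ?thesis
    using assms by simp
qed

lemma proj_idn_uni:
  assumes "A \<in> Ob C"
  shows "proj C A (idn C \<one>) = runit C A"
  using assms by (simp add: tens_idem_def)

lemma proj_uni:
  assumes "u \<in> Ar C" "Cod C u = \<one>"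
  shows "proj C \<one> u = u \<cdot> lunit C (Dom C u)"
  using assms lunit_natural[of u] by (simp add: tens_idem_def lunit_uni)

lemma tens_idem_conv_proj:
  assumes "f \<in> Ar C" "u \<in> Ar C" "Cod C u = \<one>"
  shows "tens_idem C f u = f \<cdot> proj C (Dom C f) u"
proof -
  have "tens_idem C f u = proj C (Cod C f) u \<cdot> (f \<boxtimes> idn C (Dom C u))"
    using assms by (simp add: tens_idem_def)
  then show ?thesis
    using assms by (simp add: proj_natural)
qed

text \<open>Naturality of the associator moves \<open>u\<close> to the outer position, and
  \<open>runit_tens\<close> absorbs the associator.\<close>

lemma proj_assoc:
  assumes "A \<in> Ob C" "B \<in> Ob C" "u \<in> Ar C" "Cod C u = \<one>"
  shows "proj C (A \<otimes> B) u \<cdot> assoc C A B (Dom C u) = idn C A \<boxtimes> proj C B u"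
proof -
  have "proj C (A \<otimes> B) u \<cdot> assoc C A B (Dom C u)
    = runit C (A \<otimes> B) \<cdot> (assoc C A B \<one> \<cdot> (idn C A \<boxtimes> (idn C B \<boxtimes> u)))"
    using assms assoc_natural[of "idn C A" "idn C B" u] by (simp add: tens_idem_def)
  also have "\<dots> = (runit C (A \<otimes> B) \<cdot> assoc C A B \<one>) \<cdot> (idn C A \<boxtimes> (idn C B \<boxtimes> u))"
    using assms by (subst cmp_assoc_right) auto
  finally show ?thesis
    using assms by (simp add: runit_tens) (simp add: tens_idem_def)
qed

lemma central_idempotent:
  assumes "u \<in> central_idempotents C"
  shows "u \<in> Ar C" "Cod C u = \<one>"
    "proj C (Dom C u) u = lunit C (Dom C u) \<cdot> (u \<boxtimes> idn C (Dom C u))"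
    "is_iso C (proj C (Dom C u) u)"
  using assms by (auto simp: central_idempotents_def tens_idem_def)

lemma central_idempotentI:
  assumes "u \<in> Ar C" "Cod C u = \<one>"
    "proj C (Dom C u) u = lunit C (Dom C u) \<cdot> (u \<boxtimes> idn C (Dom C u))"
    "is_iso C (proj C (Dom C u) u)"
  shows "u \<in> central_idempotents C"
  using assms by (auto simp: central_idempotents_def tens_idem_def)

declare central_idempotent(1,2) [simp]

lemma idn_uni_central_idempotent [simp]: "idn C \<one> \<in> central_idempotents C"
  by (rule central_idempotentI) (simp_all add: proj_idn_uni lunit_uni)

text \<open>The definition of centrality is the case of the unit object up to unitors. Tensor that
  equation with \<open>A\<close> on the left; the triangle trades the left unitor for a right unitor
  on \<open>A\<close>, and the associator cancels.\<close>

lemma proj_tens: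
  assumes A: "A \<in> Ob C" and u: "u \<in> central_idempotents C"
  shows "proj C (A \<otimes> Dom C u) u = proj C A u \<boxtimes> idn C (Dom C u)"
proof (rule iso_epic)
  let ?U = "Dom C u"
  have U: "?U \<in> Ob C"
    using u by simp
  have "proj C (A \<otimes> ?U) u \<cdot> assoc C A ?U ?U = idn C A \<boxtimes> proj C ?U u"
    using A u U by (simp add: proj_assoc)
  also have "\<dots> = (idn C A \<boxtimes> lunit C ?U) \<cdot> (idn C A \<boxtimes> (u \<boxtimes> idn C ?U))"
    using A u U by (simp add: central_idempotent(3))
  also have "\<dots> = ((runit C A \<boxtimes> idn C ?U) \<cdot> assoc C A \<one> ?U) \<cdot> (idn C A \<boxtimes> (u \<boxtimes> idn C ?U))"
    using A U by (simp only: triangle)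
  also have "\<dots> = (runit C A \<boxtimes> idn C ?U) \<cdot> (assoc C A \<one> ?U \<cdot> (idn C A \<boxtimes> (u \<boxtimes> idn C ?U)))"
    using A u U by (subst cmp_assoc_right) auto
  also have "\<dots> = (runit C A \<boxtimes> idn C ?U) \<cdot> (((idn C A \<boxtimes> u) \<boxtimes> idn C ?U) \<cdot> assoc C A ?U ?U)"
    using A u U assoc_natural[of "idn C A" u "idn C ?U"] by simp
  also have "\<dots> = (proj C A u \<boxtimes> idn C ?U) \<cdot> assoc C A ?U ?U"
    using A u U by simp (simp add: tens_idem_def)
  finally show "proj C (A \<otimes> ?U) u \<cdot> assoc C A ?U ?U = (proj C A u \<boxtimes> idn C ?U) \<cdot> assoc C A ?U ?U" .
qed (use assms in simp_all)

text \<open>Up to an associator this is \<open>A\<close> tensored with the arrow whose invertibility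
  belongs to the definition of a central idempotent.\<close>

lemma is_iso_proj_tens [simp]:
  assumes A: "A \<in> Ob C" and u: "u \<in> central_idempotents C"
  shows "is_iso C (proj C (A \<otimes> Dom C u) u)"
proof -
  let ?U = "Dom C u"
  have "(proj C (A \<otimes> ?U) u \<cdot> assoc C A ?U ?U) \<cdot> inv_ar C (assoc C A ?U ?U)
    = (idn C A \<boxtimes> proj C ?U u) \<cdot> inv_ar C (assoc C A ?U ?U)"
    using A u by (simp only: proj_assoc central_idempotent Dom_in)
  then have "proj C (A \<otimes> ?U) u = (idn C A \<boxtimes> proj C ?U u) \<cdot> inv_ar C (assoc C A ?U ?U)"
    using A u by (subst (asm) cmp_assoc_right) simp_all
  also have "is_iso C \<dots>"
    using A u by (intro is_iso_cmp is_iso_tensa) (simp_all add: central_idempotent(4))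
  finally show ?thesis .
qed

text \<open>By naturality of the projection, the objects on which \<open>u\<close> projects
  invertibly are closed under isomorphism.\<close>

lemma is_iso_proj_cong:
  assumes "is_iso C f" "u \<in> Ar C" "Cod C u = \<one>" "is_iso C (proj C (Cod C f) u)"
  shows "is_iso C (proj C (Dom C f) u)"
proof -
  have f: "f \<in> Ar C"
    using assms(1) by (rule is_iso_ar)
  have "inv_ar C f \<cdot> (proj C (Cod C f) u \<cdot> (f \<boxtimes> idn C (Dom C u))) = proj C (Dom C f) u"
    using assms f by (simp add: proj_natural)
  moreover have "is_iso C (inv_ar C f \<cdot> (proj C (Cod C f) u \<cdot> (f \<boxtimes> idn C (Dom C u))))"
    using assms f by simp
  ultimately show ?thesis
    by simp
qed

end

section \<open>Stiff categories and restriction to an idempotent\<close>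

context stiff_category
begin

text \<open>Take both idempotents of the stiffness square to be \<open>u\<close>. By
  \<open>proj_tens\<close> its two legs coincide, so the factorisation of the pair \<open>g\<close>,
  \<open>h\<close> through the pullback makes both equal to the same composite.\<close>

lemma proj_monic:
  assumes u: "u \<in> central_idempotents C" and A: "A \<in> Ob C"
    and g: "g \<in> Ar C" "Cod C g = A \<otimes> Dom C u" and h: "h \<in> Ar C" "Cod C h = A \<otimes> Dom C u"
    and d: "Dom C g = Dom C h" and eq: "proj C A u \<cdot> g = proj C A u \<cdot> h"
  shows "g = h"
proof -
  let ?q = "proj C (A \<otimes> Dom C u) u"
  have "is_pullback C ?q ?q (proj C A u) (proj C A u)"
    using stiff[OF A u u] A u by (simp add: proj_tens)
  moreover have "Dom C g \<in> Ob C" "g \<in> hom C (Dom C g) (Dom C (proj C A u))"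
    "h \<in> hom C (Dom C g) (Dom C (proj C A u))"
    using u A g h d by (auto simp: hom_def)
  ultimately obtain l where "?q \<cdot> l = g" "?q \<cdot> l = h"
    using eq unfolding is_pullback_def by blast
  then show ?thesis
    by simp
qed

text \<open>Up to the left unitor, \<open>u\<close> is its own projection at the unit object, by
  \<open>proj_uni\<close>.\<close>

lemma central_idempotent_monic:
  assumes u: "u \<in> central_idempotents C"
    and g: "g \<in> Ar C" "Cod C g = Dom C u" and h: "h \<in> Ar C" "Cod C h = Dom C u"
    and d: "Dom C g = Dom C h" and eq: "u \<cdot> g = u \<cdot> h"
  shows "g = h"
proof -
  let ?l = "inv_ar C (lunit C (Dom C u))"
  have "proj C \<one> u \<cdot> (?l \<cdot> g) = proj C \<one> u \<cdot> (?l \<cdot> h)"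
    using u g h eq by (simp add: proj_uni)
  then have "?l \<cdot> g = ?l \<cdot> h"
    by (rule proj_monic[OF u uni_in, rotated -1]) (use u g h d in simp_all)
  then show ?thesis
    by (rule iso_monic[rotated -1]) (use u g h d in simp_all)
qed

lemma idem_arr_eqI:
  assumes v: "v \<in> central_idempotents C" and m: "m \<in> hom C (Dom C u) (Dom C v)" and "u = v \<cdot> m"
  shows "idem_arr C u v = m"
  unfolding idem_arr_def
proof (rule the_equality)
  show "n = m" if "n \<in> hom C (Dom C u) (Dom C v) \<and> u = v \<cdot> n" for n
  proof (rule central_idempotent_monic[OF v])
    show "v \<cdot> n = v \<cdot> m"
      using that \<open>u = v \<cdot> m\<close> by metis
  qed (use that m in \<open>auto simp: hom_def\<close>)
qed (use assms in blast)

lemma idem_leE: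
  assumes v: "v \<in> central_idempotents C" and "idem_le C u v"
  obtains m where "m \<in> Ar C" "Dom C m = Dom C u" "Cod C m = Dom C v" "v \<cdot> m = u" "idem_arr C u v = m"
proof -
  obtain m where m: "m \<in> hom C (Dom C u) (Dom C v)" "u = v \<cdot> m"
    using assms by (auto simp: idem_le_def)
  from m(1) have "m \<in> Ar C" "Dom C m = Dom C u" "Cod C m = Dom C v"
    by (auto simp: hom_def)
  then show thesis
    using m(2)[symmetric] idem_arr_eqI[OF v m] by (rule that)
qed

text \<open>The last two equations exhibit the arrows that witness that \<open>u \<otimes> v\<close>
  lies below \<open>u\<close> and below \<open>v\<close>.\<close>

lemma idem_tens_conv:
  assumes u: "u \<in> central_idempotents C" and v: "v \<in> central_idempotents C"
  shows "Dom C (idem_tens C u v) = Dom C u \<otimes> Dom C v"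
    "idem_tens C u v = u \<cdot> proj C (Dom C u) v"
    "idem_tens C u v = v \<cdot> (lunit C (Dom C v) \<cdot> (u \<boxtimes> idn C (Dom C v)))"
proof -
  show "Dom C (idem_tens C u v) = Dom C u \<otimes> Dom C v"
    using u v by (simp add: idem_tens_def)
  show "idem_tens C u v = u \<cdot> proj C (Dom C u) v"
    using u v proj_natural[of u v \<one>] by (simp add: idem_tens_def lunit_uni tens_idem_def)
  show "idem_tens C u v = v \<cdot> (lunit C (Dom C v) \<cdot> (u \<boxtimes> idn C (Dom C v)))"
    using u v lunit_tensa[of u v] by (simp add: idem_tens_def)
qed

text \<open>Centrality is checked after composition with the monic \<open>?w\<close>. Invertibility
  holds because the projection of \<open>?w\<close> splits, up to an associator, into projections of
  \<open>v\<close> and \<open>u\<close> that are invertible at the objects concerned.\<close>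

lemma idem_tens_central_idempotent [simp]:
  assumes u: "u \<in> central_idempotents C" and v: "v \<in> central_idempotents C"
  shows "idem_tens C u v \<in> central_idempotents C"
proof (rule central_idempotentI)
  let ?w = "idem_tens C u v" and ?U = "Dom C u" and ?V = "Dom C v"
  let ?W = "?U \<otimes> ?V"
  have o: "?U \<in> Ob C" "?V \<in> Ob C"
    using u v by simp_all
  have w: "?w \<in> Ar C" "Cod C ?w = \<one>" "Dom C ?w = ?W"
    using u v by (simp_all add: idem_tens_def)
  show "?w \<in> Ar C" "Cod C ?w = \<one>"
    by fact+
  \<comment> \<open>Centrality of \<open>?w\<close> is still to be shown, so its monicity is
    obtained from that of \<open>u\<close> and of the projection of \<open>v\<close>.\<close>
  have monic: "g = h" if "g \<in> Ar C" "Cod C g = ?W" "h \<in> Ar C" "Cod C h = ?W" "Dom C g = Dom C h"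
    "?w \<cdot> g = ?w \<cdot> h" for g h
  proof -
    have "u \<cdot> (proj C ?U v \<cdot> g) = u \<cdot> (proj C ?U v \<cdot> h)"
      using that u v o by (simp add: idem_tens_conv(2))
    then have "proj C ?U v \<cdot> g = proj C ?U v \<cdot> h"
      by (rule central_idempotent_monic[OF u, rotated -1]) (use that u v o in simp_all)
    then show ?thesis
      by (rule proj_monic[OF v o(1), rotated -1]) (use that in simp_all)
  qed
  \<comment> \<open>After composition with \<open>?w\<close> both sides become
    \<open>?w \<boxtimes> ?w\<close> followed by a unitor at the unit object, where the two unitors
    agree.\<close>
  have "?w \<cdot> (lunit C ?W \<cdot> (?w \<boxtimes> idn C ?W)) = lunit C \<one> \<cdot> (?w \<boxtimes> ?w)"
    using w o lunit_tensa[of ?w ?w] by simp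
  moreover have "?w \<cdot> proj C ?W ?w = runit C \<one> \<cdot> (?w \<boxtimes> ?w)"
    using w o proj_natural[of ?w ?w] by (simp add: tens_idem_def)
  ultimately have "?w \<cdot> proj C (Dom C ?w) ?w = ?w \<cdot> (lunit C (Dom C ?w) \<cdot> (?w \<boxtimes> idn C (Dom C ?w)))"
    by (simp only: w lunit_uni)
  then show "proj C (Dom C ?w) ?w = lunit C (Dom C ?w) \<cdot> (?w \<boxtimes> idn C (Dom C ?w))"
    by (rule monic[rotated -1]) (use w o in \<open>simp_all add: lunit_uni\<close>)
  \<comment> \<open>The symmetry moves \<open>?U\<close> to the right, where
    \<open>is_iso_proj_tens\<close> applies.\<close>
  have pu: "is_iso C (proj C ?W u)"
    using is_iso_proj_cong[of "symm C ?U ?V" u] u o by simp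
  \<comment> \<open>The isomorphism \<open>pu\<close> itself relates \<open>?W \<otimes> ?U\<close>
    to \<open>?W\<close>, on which \<open>v\<close> projects invertibly.\<close>
  have pv: "is_iso C (proj C (?W \<otimes> ?U) v)"
    using is_iso_proj_cong[OF pu, of v] u v o by simp
  have "proj C ?W u \<cdot> (proj C (?W \<otimes> ?U) v \<cdot> assoc C ?W ?U ?V) = proj C ?W ?w"
    using u v o w by (simp add: proj_assoc proj_tensa idem_tens_conv(2))
  moreover have "is_iso C (proj C ?W u \<cdot> (proj C (?W \<otimes> ?U) v \<cdot> assoc C ?W ?U ?V))"
    using pu pv u v o by simp
  ultimately show "is_iso C (proj C (Dom C ?w) ?w)"
    using w by simp
qed

text \<open>The last factor is the diagonal \<open>A \<otimes> W \<rightarrow> (A \<otimes> W) \<otimes> W\<close> for \<open>w = u \<otimes> v\<close>; the first is built from the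
  arrows witnessing \<open>w \<le> u\<close> and \<open>w \<le> v\<close>.\<close>

lemma assoc_conv_diagonal:
  assumes A: "A \<in> Ob C" and u: "u \<in> central_idempotents C" and v: "v \<in> central_idempotents C"
  defines "w \<equiv> idem_tens C u v"
  shows "assoc C A (Dom C u) (Dom C v)
    = ((idn C A \<boxtimes> proj C (Dom C u) v) \<boxtimes> (lunit C (Dom C v) \<cdot> (u \<boxtimes> idn C (Dom C v))))
      \<cdot> inv_ar C (proj C (A \<otimes> Dom C w) w)"
    (is "_ = ((_ \<boxtimes> ?m) \<boxtimes> ?n) \<cdot> ?d")
\<comment> \<open>After projecting \<open>v\<close> away, both sides reduce to
  \<open>idn C A \<boxtimes> ?m\<close>: the left by \<open>proj_assoc\<close>, the right because
  \<open>?d\<close> inverts the projection of \<open>w\<close>.\<close>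
proof (rule proj_monic[OF v])
  let ?U = "Dom C u" and ?V = "Dom C v"
  let ?W = "?U \<otimes> ?V"
  have o: "?U \<in> Ob C" "?V \<in> Ob C"
    using u v by simp_all
  have w: "w \<in> central_idempotents C" "Dom C w = ?W"
    using u v by (simp_all add: w_def idem_tens_conv(1))
  have i: "is_iso C (proj C (A \<otimes> ?W) w)"
    using is_iso_proj_tens[OF A w(1)] w by simp
  have d: "?d \<in> Ar C" "Dom C ?d = A \<otimes> ?W" "Cod C ?d = (A \<otimes> ?W) \<otimes> ?W"
    using A o w i by simp_all
  have e: "proj C (A \<otimes> ?W) w \<cdot> ?d = idn C (A \<otimes> ?W)"
    using A o w i by simp
  have n: "v \<cdot> ?n = w"
    using u v by (simp add: w_def idem_tens_conv(3))
  have "proj C (A \<otimes> ?U) v \<cdot> (((idn C A \<boxtimes> ?m) \<boxtimes> ?n) \<cdot> ?d)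
    = (proj C (A \<otimes> ?U) v \<cdot> ((idn C A \<boxtimes> ?m) \<boxtimes> ?n)) \<cdot> ?d"
    using A u v o d by (subst cmp_assoc_right) simp_all
  also have "\<dots> = (idn C A \<boxtimes> ?m) \<cdot> (proj C (A \<otimes> ?W) w \<cdot> ?d)"
    using A u v o d n w by (simp add: proj_tensa)
  also have "\<dots> = idn C A \<boxtimes> ?m"
    unfolding e using A u v o by simp
  finally show "proj C (A \<otimes> ?U) v \<cdot> assoc C A ?U ?V
    = proj C (A \<otimes> ?U) v \<cdot> (((idn C A \<boxtimes> ?m) \<boxtimes> ?n) \<cdot> ?d)"
    using A u v o by (simp add: proj_assoc)
  show "(((idn C A \<boxtimes> ?m) \<boxtimes> ?n) \<cdot> ?d) \<in> Ar C" "Cod C (((idn C A \<boxtimes> ?m) \<boxtimes> ?n) \<cdot> ?d) = (A \<otimes> ?U) \<otimes> ?V"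
    "Dom C (assoc C A ?U ?V) = Dom C (((idn C A \<boxtimes> ?m) \<boxtimes> ?n) \<cdot> ?d)"
    using A u v o d by simp_all
qed (use A u v in simp_all)

text \<open>The action on arrows of the identity-on-objects functor from C to the fibre at
  \<open>u\<close>: \<open>to_top\<close> followed by restriction from the top idempotent to
  \<open>u\<close>.\<close>

definition restr_ar :: "'a \<Rightarrow> 'a \<Rightarrow> 'o \<times> 'a" where
  "restr_ar u f = (Dom C f, f \<cdot> proj C (Dom C f) u)"

text \<open>When one factor is a restricted arrow, its projection cancels the inverse built into
  composition in the fibre, by naturality in the first case and by \<open>proj_tens\<close> in the
  second. Fibre equations thereby become equations in C.\<close>

lemma restr_cmp_restr_ar:
  assumes u: "u \<in> central_idempotents C" and g: "g \<in> Ar C"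
  shows "A \<in> Ob C \<Longrightarrow> f \<in> Ar C \<Longrightarrow> Dom C f = A \<otimes> Dom C u \<Longrightarrow> Cod C f = Dom C g
      \<Longrightarrow> cmp (restr_cat C u) (restr_ar u g) (A, f) = (A, g \<cdot> f)"
    "f \<in> Ar C \<Longrightarrow> Dom C g = B \<otimes> Dom C u \<Longrightarrow> Cod C f = B
      \<Longrightarrow> cmp (restr_cat C u) (B, g) (restr_ar u f) = (Dom C f, g \<cdot> (f \<boxtimes> idn C (Dom C u)))"
proof -
  let ?U = "Dom C u"
  assume f: "A \<in> Ob C" "f \<in> Ar C" "Dom C f = A \<otimes> ?U" "Cod C f = Dom C g"
  have "proj C (Dom C g) u \<cdot> ((f \<boxtimes> idn C ?U) \<cdot> inv_ar C (proj C (A \<otimes> ?U) u))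
    = (proj C (Dom C g) u \<cdot> (f \<boxtimes> idn C ?U)) \<cdot> inv_ar C (proj C (A \<otimes> ?U) u)"
    using u g f by (subst cmp_assoc_right) simp_all
  also have "\<dots> = f"
    using u f by (simp add: proj_natural)
  finally show "cmp (restr_cat C u) (restr_ar u g) (A, f) = (A, g \<cdot> f)"
    using u g f by (simp add: restr_ar_def)
next
  let ?U = "Dom C u"
  assume f: "f \<in> Ar C" "Dom C g = B \<otimes> ?U" "Cod C f = B"
  let ?A = "Dom C f"
  have "((f \<cdot> proj C ?A u) \<boxtimes> idn C ?U) \<cdot> inv_ar C (proj C (?A \<otimes> ?U) u)
    = ((f \<boxtimes> idn C ?U) \<cdot> proj C (?A \<otimes> ?U) u) \<cdot> inv_ar C (proj C (?A \<otimes> ?U) u)"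
    using u f by (simp add: proj_tens)
  also have "\<dots> = f \<boxtimes> idn C ?U"
    using u f by (subst cmp_assoc_right) simp_all
  finally show "cmp (restr_cat C u) (B, g) (restr_ar u f) = (?A, g \<cdot> (f \<boxtimes> idn C ?U))"
    by (simp add: restr_ar_def)
qed

lemma restr_ar_simps [simp]:
  assumes "u \<in> central_idempotents C" "f \<in> Ar C"
  shows "restr_ar u f \<in> Ar (restr_cat C u)" "Dom (restr_cat C u) (restr_ar u f) = Dom C f"
    "Cod (restr_cat C u) (restr_ar u f) = Cod C f"
  using assms by (simp_all add: restr_ar_def)

lemma restr_ar_idn:
  assumes "u \<in> central_idempotents C" "A \<in> Ob C"
  shows "restr_ar u (idn C A) = (A, proj C A u)"
  using assms by (simp add: restr_ar_def)

lemma restr_ar_cmp: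
  assumes "u \<in> central_idempotents C" "f \<in> Ar C" "g \<in> Ar C" "Cod C f = Dom C g"
  shows "cmp (restr_cat C u) (restr_ar u g) (restr_ar u f) = restr_ar u (g \<cdot> f)"
proof -
  have "cmp (restr_cat C u) (restr_ar u g) (Dom C f, f \<cdot> proj C (Dom C f) u)
    = (Dom C f, g \<cdot> (f \<cdot> proj C (Dom C f) u))"
    using assms by (intro restr_cmp_restr_ar) simp_all
  then show ?thesis
    using assms by (simp add: restr_ar_def)
qed

lemma to_top_conv: "f \<in> Ar C \<Longrightarrow> to_top C f = restr_ar (idn C \<one>) f"
  by (simp add: to_top_def restr_ar_def proj_idn_uni)

lemma from_top_restr_ar [simp]: "f \<in> Ar C \<Longrightarrow> from_top C (restr_ar (idn C \<one>) f) = f"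
  by (simp add: from_top_def restr_ar_def proj_idn_uni)

lemma from_top_ar [simp]:
  assumes "x \<in> Ar (restr_cat C (idn C \<one>))"
  shows "from_top C x \<in> Ar C" "Dom C (from_top C x) = Dom (restr_cat C (idn C \<one>)) x"
    "Cod C (from_top C x) = Cod (restr_cat C (idn C \<one>)) x"
    "restr_ar (idn C \<one>) (from_top C x) = x"
  using assms by (cases x; simp add: from_top_def restr_ar_def proj_idn_uni)+

text \<open>Used to read equations in the top fibre back as equations in C.\<close>

lemma restr_ar_top_inject:
  assumes "f \<in> Ar C" "g \<in> Ar C" "restr_ar (idn C \<one>) f = restr_ar (idn C \<one>) g"
  shows "f = g"
  using assms from_top_restr_ar by metis

lemma restr_functor_restr_ar:
  assumes "u \<in> central_idempotents C" "v \<in> central_idempotents C" "idem_le C u v" "f \<in> Ar C"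
  shows "on_ar (restr_functor C u v) (restr_ar v f) = restr_ar u f"
proof -
  obtain m where "m \<in> Ar C" "Dom C m = Dom C u" "Cod C m = Dom C v" "v \<cdot> m = u" "idem_arr C u v = m"
    using assms(2,3) by (rule idem_leE)
  then show ?thesis
    using assms(1,2,4) by (simp add: restr_ar_def proj_tensa)
qed

end

section \<open>From localisable monads to formal monads\<close>

text \<open>Localisable monads without the associativity of the strength, which turns out to follow from
  naturality in the idempotent.\<close>

locale localised_monad = stiff_category C for C :: "('o, 'a) smc" (structure) +
  fixes L :: "('o, 'a) lmonad"
  assumes is_monad: "is_monad C L"
    and st_extensional: "st L \<in> extensional (Ob C)"
      "A \<in> Ob C \<Longrightarrow> st L A \<in> extensional (central_idempotents C)"
    and st_hom: "A \<in> Ob C \<Longrightarrow> u \<in> central_idempotents C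
      \<Longrightarrow> st L A u \<in> hom C (on_ob (endo L) A \<otimes> Dom C u) (on_ob (endo L) (A \<otimes> Dom C u))"
    and st_unit: "A \<in> Ob C
      \<Longrightarrow> on_ar (endo L) (runit C A) \<cdot> st L A (idn C \<one>) = runit C (on_ob (endo L) A)"
    and st_eta: "A \<in> Ob C \<Longrightarrow> u \<in> central_idempotents C
      \<Longrightarrow> eta L (A \<otimes> Dom C u) = st L A u \<cdot> (eta L A \<boxtimes> idn C (Dom C u))"
    and st_mu: "A \<in> Ob C \<Longrightarrow> u \<in> central_idempotents C
      \<Longrightarrow> mu L (A \<otimes> Dom C u) \<cdot> (on_ar (endo L) (st L A u) \<cdot> st L (on_ob (endo L) A) u)
        = st L A u \<cdot> (mu L A \<boxtimes> idn C (Dom C u))"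
    and st_idem: "A \<in> Ob C \<Longrightarrow> u \<in> central_idempotents C \<Longrightarrow> v \<in> central_idempotents C
      \<Longrightarrow> m \<in> hom C (Dom C u) (Dom C v) \<Longrightarrow> u = v \<cdot> m
      \<Longrightarrow> st L A v \<cdot> (idn C (on_ob (endo L) A) \<boxtimes> m) = on_ar (endo L) (idn C A \<boxtimes> m) \<cdot> st L A u"
    and st_natural: "f \<in> Ar C \<Longrightarrow> u \<in> central_idempotents C
      \<Longrightarrow> st L (Cod C f) u \<cdot> (on_ar (endo L) f \<boxtimes> idn C (Dom C u))
        = on_ar (endo L) (f \<boxtimes> idn C (Dom C u)) \<cdot> st L (Dom C f) u"
begin

abbreviation T :: "'o \<Rightarrow> 'o" where "T \<equiv> on_ob (endo L)"
abbreviation Ta :: "'a \<Rightarrow> 'a" where "Ta \<equiv> on_ar (endo L)"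

lemma endo_functor: "is_functor C C (endo L)"
  using is_monad by (simp add: is_monad_iff)

lemmas Ta_simps [simp] = is_functorD(3-8)[OF endo_functor]

lemma eta_mu_ar [simp]:
  assumes "A \<in> Ob C"
  shows "eta L A \<in> Ar C" "Dom C (eta L A) = A" "Cod C (eta L A) = T A"
    "mu L A \<in> Ar C" "Dom C (mu L A) = T (T A)" "Cod C (mu L A) = T A"
  using is_monad assms by (auto simp: is_monad_iff hom_def)

lemma eta_mu_natural:
  assumes "f \<in> Ar C"
  shows "eta L (Cod C f) \<cdot> f = Ta f \<cdot> eta L (Dom C f)"
    "mu L (Cod C f) \<cdot> Ta (Ta f) = Ta f \<cdot> mu L (Dom C f)"
  using is_monad assms by (auto simp: is_monad_iff)

lemma st_ar [simp]:
  assumes "A \<in> Ob C" "u \<in> central_idempotents C"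
  shows "st L A u \<in> Ar C" "Dom C (st L A u) = T A \<otimes> Dom C u" "Cod C (st L A u) = T (A \<otimes> Dom C u)"
  using st_hom[OF assms] by (simp_all add: hom_def)

text \<open>The arrow \<open>u\<close> itself mediates from \<open>u\<close> to the top idempotent,
  so \<open>st_idem\<close> reduces the claim to \<open>st_unit\<close>. This is what makes
  \<open>T|_u\<close> preserve identities.\<close>

lemma Ta_proj_st:
  assumes A: "A \<in> Ob C" and u: "u \<in> central_idempotents C"
  shows "Ta (proj C A u) \<cdot> st L A u = proj C (T A) u"
proof -
  let ?U = "Dom C u"
  have "Ta (proj C A u) \<cdot> st L A u = Ta (runit C A) \<cdot> (Ta (idn C A \<boxtimes> u) \<cdot> st L A u)"
    using A u by (simp add: tens_idem_def)
  also have "Ta (idn C A \<boxtimes> u) \<cdot> st L A u = st L A (idn C \<one>) \<cdot> (idn C (T A) \<boxtimes> u)"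
    using A u by (intro st_idem[symmetric]) (simp_all add: hom_def)
  also have "Ta (runit C A) \<cdot> \<dots> = (Ta (runit C A) \<cdot> st L A (idn C \<one>)) \<cdot> (idn C (T A) \<boxtimes> u)"
    using A u by (subst cmp_assoc_right) simp_all
  also have "\<dots> = proj C (T A) u"
    using A u by (simp add: st_unit tens_idem_def)
  finally show ?thesis .
qed

text \<open>Needed for \<open>T|_u\<close> to preserve composition, whose formula contains this
  inverse. After composition with the invertible \<open>Ta ?p\<close>, the equation follows from
  \<open>Ta_proj_st\<close> at \<open>A \<otimes> U\<close> and naturality of the
  projection.\<close>

lemma Ta_inv_ar_proj_st:
  assumes A: "A \<in> Ob C" and u: "u \<in> central_idempotents C"
  shows "Ta (inv_ar C (proj C (A \<otimes> Dom C u) u)) \<cdot> st L A u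
    = st L (A \<otimes> Dom C u) u \<cdot> ((st L A u \<boxtimes> idn C (Dom C u)) \<cdot> inv_ar C (proj C (T A \<otimes> Dom C u) u))"
proof (rule iso_monic)
  let ?U = "Dom C u"
  let ?p = "proj C (A \<otimes> ?U) u" and ?d = "inv_ar C (proj C (T A \<otimes> ?U) u)"
  show "is_iso C (Ta ?p)"
    using A u by (intro functor_is_iso[OF endo_functor]) simp
  have inv: "Ta ?p \<cdot> Ta (inv_ar C ?p) = idn C (T (A \<otimes> ?U))"
    using A u by (simp flip: Ta_simps(6))
  have "Ta ?p \<cdot> (Ta (inv_ar C ?p) \<cdot> st L A u) = (Ta ?p \<cdot> Ta (inv_ar C ?p)) \<cdot> st L A u"
    using A u by (subst cmp_assoc_right) simp_all
  also have "\<dots> = st L A u"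
    unfolding inv using A u by simp
  also have "\<dots> = (st L A u \<cdot> proj C (T A \<otimes> ?U) u) \<cdot> ?d"
    using A u by simp
  also have "\<dots> = (proj C (T (A \<otimes> ?U)) u \<cdot> (st L A u \<boxtimes> idn C ?U)) \<cdot> ?d"
    using A u by (simp add: proj_natural)
  also have "\<dots> = ((Ta ?p \<cdot> st L (A \<otimes> ?U) u) \<cdot> (st L A u \<boxtimes> idn C ?U)) \<cdot> ?d"
    using A u by (simp add: Ta_proj_st)
  also have "\<dots> = Ta ?p \<cdot> (st L (A \<otimes> ?U) u \<cdot> ((st L A u \<boxtimes> idn C ?U) \<cdot> ?d))"
    using A u by simp
  finally show "Ta ?p \<cdot> (Ta (inv_ar C ?p) \<cdot> st L A u)
    = Ta ?p \<cdot> (st L (A \<otimes> ?U) u \<cdot> ((st L A u \<boxtimes> idn C ?U) \<cdot> ?d))" .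
qed (use assms in simp_all)

lemma st_natural_idem:
  assumes f: "f \<in> Ar C" and u: "u \<in> central_idempotents C" and v: "v \<in> central_idempotents C"
    and m: "m \<in> hom C (Dom C u) (Dom C v)" "u = v \<cdot> m"
  shows "st L (Cod C f) v \<cdot> (Ta f \<boxtimes> m) = Ta (f \<boxtimes> m) \<cdot> st L (Dom C f) u"
proof -
  let ?V = "Dom C v" and ?A = "Dom C f"
  have m': "m \<in> Ar C" "Dom C m = Dom C u" "Cod C m = ?V"
    using m(1) by (auto simp: hom_def)
  note [simp] = f u v m'
  have "st L (Cod C f) v \<cdot> (Ta f \<boxtimes> m)
    = (st L (Cod C f) v \<cdot> (Ta f \<boxtimes> idn C ?V)) \<cdot> (idn C (T ?A) \<boxtimes> m)"
    by simp
  also have "\<dots> = Ta (f \<boxtimes> idn C ?V) \<cdot> (st L ?A v \<cdot> (idn C (T ?A) \<boxtimes> m))"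
    by (simp add: st_natural)
  also have "\<dots> = Ta (f \<boxtimes> idn C ?V) \<cdot> (Ta (idn C ?A \<boxtimes> m) \<cdot> st L ?A u)"
    using st_idem[OF _ u v m, of ?A] by simp
  also have "\<dots> = Ta ((f \<boxtimes> idn C ?V) \<cdot> (idn C ?A \<boxtimes> m)) \<cdot> st L ?A u"
    by (subst Ta_simps(6)) (simp_all del: tensa_cmp)
  finally show ?thesis
    by simp
qed

text \<open>By \<open>assoc_conv_diagonal\<close> the associator is a diagonal followed by a tensor
  of comparison arrows. The strength passes the diagonal by \<open>Ta_inv_ar_proj_st\<close>, and
  the comparison arrows by naturality in the object and in the idempotent.\<close>

lemma st_assoc:
  assumes A: "A \<in> Ob C" and u: "u \<in> central_idempotents C" and v: "v \<in> central_idempotents C"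
  shows "Ta (assoc C A (Dom C u) (Dom C v)) \<cdot> st L A (idem_tens C u v)
    = st L (A \<otimes> Dom C u) v \<cdot> ((st L A u \<boxtimes> idn C (Dom C v)) \<cdot> assoc C (T A) (Dom C u) (Dom C v))"
proof -
  let ?U = "Dom C u" and ?V = "Dom C v" and ?w = "idem_tens C u v"
  let ?W = "?U \<otimes> ?V"
  define m n where "m = proj C ?U v" and "n = lunit C ?V \<cdot> (u \<boxtimes> idn C ?V)"
  define d where "d = (\<lambda>X. inv_ar C (proj C (X \<otimes> ?W) ?w))"
  note [simp] = A u v
  have W [simp]: "?U \<in> Ob C" "?V \<in> Ob C" "?W \<in> Ob C" "Dom C ?w = ?W"
    by (simp_all add: idem_tens_conv(1))
  have mn [simp]: "m \<in> Ar C" "Dom C m = ?W" "Cod C m = ?U" "n \<in> Ar C" "Dom C n = ?W" "Cod C n = ?V"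
    by (simp_all add: m_def n_def)
  \<comment> \<open>So \<open>m\<close> and \<open>n\<close> witness that \<open>?w\<close> lies
    below \<open>u\<close> and below \<open>v\<close>.\<close>
  have w: "?w = u \<cdot> m" "?w = v \<cdot> n"
    by (simp_all only: m_def n_def idem_tens_conv(2) u v) (simp_all only: idem_tens_conv(3) u v flip: idem_tens_conv(2))
  have d [simp]: "d X \<in> Ar C" "Dom C (d X) = X \<otimes> ?W" "Cod C (d X) = (X \<otimes> ?W) \<otimes> ?W" if "X \<in> Ob C" for X
    using is_iso_proj_tens[OF that, of ?w] that by (simp_all add: d_def)
  \<comment> \<open>Used at \<open>A\<close> to open the associator under \<open>Ta\<close>, and at
    \<open>T A\<close> to close it again at the end.\<close>
  have a: "assoc C X ?U ?V = ((idn C X \<boxtimes> m) \<boxtimes> n) \<cdot> d X" if "X \<in> Ob C" for X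
    using assoc_conv_diagonal[OF that u v] by (simp add: m_def n_def d_def)
  have "Ta (assoc C A ?U ?V) \<cdot> st L A ?w = Ta ((idn C A \<boxtimes> m) \<boxtimes> n) \<cdot> (Ta (d A) \<cdot> st L A ?w)"
    by (simp add: a)
  also have "Ta (d A) \<cdot> st L A ?w = st L (A \<otimes> ?W) ?w \<cdot> ((st L A ?w \<boxtimes> idn C ?W) \<cdot> d (T A))"
    using Ta_inv_ar_proj_st[OF A, of ?w] by (simp add: d_def)
  also have "Ta ((idn C A \<boxtimes> m) \<boxtimes> n) \<cdot> \<dots>
    = (Ta ((idn C A \<boxtimes> m) \<boxtimes> n) \<cdot> st L (A \<otimes> ?W) ?w) \<cdot> ((st L A ?w \<boxtimes> idn C ?W) \<cdot> d (T A))"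
    by (subst cmp_assoc_right) simp_all
  also have "Ta ((idn C A \<boxtimes> m) \<boxtimes> n) \<cdot> st L (A \<otimes> ?W) ?w = st L (A \<otimes> ?U) v \<cdot> (Ta (idn C A \<boxtimes> m) \<boxtimes> n)"
    using st_natural_idem[OF _ _ v _ w(2), of "idn C A \<boxtimes> m"] by (simp add: hom_def)
  also have "(st L (A \<otimes> ?U) v \<cdot> (Ta (idn C A \<boxtimes> m) \<boxtimes> n)) \<cdot> ((st L A ?w \<boxtimes> idn C ?W) \<cdot> d (T A))
    = st L (A \<otimes> ?U) v \<cdot> (((Ta (idn C A \<boxtimes> m) \<cdot> st L A ?w) \<boxtimes> n) \<cdot> d (T A))"
    by simp
  also have "Ta (idn C A \<boxtimes> m) \<cdot> st L A ?w = st L A u \<cdot> (idn C (T A) \<boxtimes> m)"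
    by (rule st_idem[OF A _ u _ w(1), symmetric]) (simp_all add: hom_def)
  also have "((st L A u \<cdot> (idn C (T A) \<boxtimes> m)) \<boxtimes> n) \<cdot> d (T A)
    = (st L A u \<boxtimes> idn C ?V) \<cdot> assoc C (T A) ?U ?V"
    by (simp add: a)
  finally show ?thesis .
qed

section \<open>The monads \<open>T|_u\<close> and their compatibility with restriction\<close>

lemma restr_monad_simps:
  "A \<in> Ob C \<Longrightarrow> on_ob (endo (restr_monad C L u)) A = T A"
  "A \<in> Ob C \<Longrightarrow> f \<in> Ar C \<Longrightarrow> Dom C f = A \<otimes> Dom C u
    \<Longrightarrow> on_ar (endo (restr_monad C L u)) (A, f) = (T A, Ta f \<cdot> st L A u)"
  "A \<in> Ob C \<Longrightarrow> u \<in> central_idempotents C \<Longrightarrow> eta (restr_monad C L u) A = restr_ar u (eta L A)"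
  "A \<in> Ob C \<Longrightarrow> u \<in> central_idempotents C \<Longrightarrow> mu (restr_monad C L u) A = restr_ar u (mu L A)"
  using tens_idem_conv_proj[of "eta L A" u] tens_idem_conv_proj[of "mu L A" u]
  by (simp_all add: restr_monad_def Let_def restr_ar_def)

text \<open>A restricted arrow ends in a projection, which \<open>Ta_proj_st\<close> moves through
  the strength.\<close>

lemma restr_monad_restr_ar:
  assumes "u \<in> central_idempotents C" "f \<in> Ar C"
  shows "on_ar (endo (restr_monad C L u)) (restr_ar u f) = restr_ar u (Ta f)"
proof -
  have "on_ar (endo (restr_monad C L u)) (restr_ar u f) = (T (Dom C f), Ta f \<cdot> (Ta (proj C (Dom C f) u) \<cdot> st L (Dom C f) u))"
    using assms by (simp add: restr_monad_simps restr_ar_def)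
  then show ?thesis
    using assms by (simp add: Ta_proj_st restr_ar_def)
qed

text \<open>Identities are preserved by \<open>Ta_proj_st\<close>. For composites,
  \<open>Ta_inv_ar_proj_st\<close> moves the strength past the inverse projection, and
  \<open>st_natural\<close> moves it past the first factor.\<close>

lemma is_functor_restr_monad:
  assumes u: "u \<in> central_idempotents C"
  shows "is_functor (restr_cat C u) (restr_cat C u) (endo (restr_monad C L u))"
proof -
  let ?U = "Dom C u" and ?F = "endo (restr_monad C L u)"
  have comp: "on_ar ?F (cmp (restr_cat C u) (B, g) (A, f))
    = cmp (restr_cat C u) (on_ar ?F (B, g)) (on_ar ?F (A, f))"
    if f: "A \<in> Ob C" "f \<in> Ar C" "Dom C f = A \<otimes> ?U" and g: "g \<in> Ar C" "Cod C f = B" "Dom C g = B \<otimes> ?U"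
    for A f B g
  proof -
    let ?d = "\<lambda>X. inv_ar C (proj C (X \<otimes> ?U) u)"
    let ?s = "st L (A \<otimes> ?U) u"
    note [simp] = u f g
    have B [simp]: "B \<in> Ob C"
      using Cod_in[OF f(2)] g(2) by simp
    have "Ta (g \<cdot> ((f \<boxtimes> idn C ?U) \<cdot> ?d A)) \<cdot> st L A u
      = Ta g \<cdot> (Ta (f \<boxtimes> idn C ?U) \<cdot> (Ta (?d A) \<cdot> st L A u))"
      by simp
    also have "\<dots> = Ta g \<cdot> ((Ta (f \<boxtimes> idn C ?U) \<cdot> ?s) \<cdot> ((st L A u \<boxtimes> idn C ?U) \<cdot> ?d (T A)))"
      by (simp add: Ta_inv_ar_proj_st)
    also have "Ta (f \<boxtimes> idn C ?U) \<cdot> ?s = st L B u \<cdot> (Ta f \<boxtimes> idn C ?U)"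
      using st_natural[of f u] by simp
    also have "Ta g \<cdot> ((st L B u \<cdot> (Ta f \<boxtimes> idn C ?U)) \<cdot> ((st L A u \<boxtimes> idn C ?U) \<cdot> ?d (T A)))
      = (Ta g \<cdot> st L B u) \<cdot> (((Ta f \<cdot> st L A u) \<boxtimes> idn C ?U) \<cdot> ?d (T A))"
      by simp
    finally show ?thesis
      by (simp add: restr_monad_simps)
  qed
  show ?thesis
    unfolding is_functor_def
  proof (intro conjI ballI impI)
    show "on_ob ?F \<in> Ob (restr_cat C u) \<rightarrow>\<^sub>E Ob (restr_cat C u)"
      by (auto simp: restr_monad_def Let_def)
    show "on_ar ?F \<in> Ar (restr_cat C u) \<rightarrow>\<^sub>E Ar (restr_cat C u)"
      using u by (auto simp: restr_monad_def Let_def)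
  next
    fix x y assume "x \<in> Ar (restr_cat C u)" "y \<in> Ar (restr_cat C u)"
      "Cod (restr_cat C u) x = Dom (restr_cat C u) y"
    then show "on_ar ?F (cmp (restr_cat C u) y x) = cmp (restr_cat C u) (on_ar ?F y) (on_ar ?F x)"
      using comp[of "fst x" "snd x" "snd y" "fst y"] by (cases x; cases y) simp
  qed (use u in \<open>auto simp: restr_monad_simps Ta_proj_st\<close>)
qed

text \<open>Naturality at an arbitrary fibre arrow combines naturality in C with
  \<open>st_eta\<close> and \<open>st_mu\<close>.\<close>

lemma is_monad_restr_monad:
  assumes u: "u \<in> central_idempotents C"
  shows "is_monad (restr_cat C u) (restr_monad C L u)"
proof -
  let ?U = "Dom C u" and ?M = "restr_monad C L u"
  have nat_eta: "cmp (restr_cat C u) (restr_ar u (eta L (Cod C f))) (A, f)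
      = cmp (restr_cat C u) (T A, Ta f \<cdot> st L A u) (restr_ar u (eta L A))"
    and nat_mu: "cmp (restr_cat C u) (restr_ar u (mu L (Cod C f))) (T (T A), Ta (Ta f \<cdot> st L A u) \<cdot> st L (T A) u)
      = cmp (restr_cat C u) (T A, Ta f \<cdot> st L A u) (restr_ar u (mu L A))"
    if f: "A \<in> Ob C" "f \<in> Ar C" "Dom C f = A \<otimes> ?U" for A f
  proof -
    note [simp] = u f
    show "cmp (restr_cat C u) (restr_ar u (eta L (Cod C f))) (A, f)
      = cmp (restr_cat C u) (T A, Ta f \<cdot> st L A u) (restr_ar u (eta L A))"
      using eta_mu_natural(1)[of f] by (simp add: restr_cmp_restr_ar st_eta)
    have "mu L (Cod C f) \<cdot> (Ta (Ta f \<cdot> st L A u) \<cdot> st L (T A) u)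
      = (mu L (Cod C f) \<cdot> Ta (Ta f)) \<cdot> (Ta (st L A u) \<cdot> st L (T A) u)"
      by simp
    also have "\<dots> = Ta f \<cdot> (mu L (A \<otimes> ?U) \<cdot> (Ta (st L A u) \<cdot> st L (T A) u))"
      using eta_mu_natural(2)[of f] by simp
    also have "\<dots> = (Ta f \<cdot> st L A u) \<cdot> (mu L A \<boxtimes> idn C ?U)"
      by (simp add: st_mu)
    finally show "cmp (restr_cat C u) (restr_ar u (mu L (Cod C f))) (T (T A), Ta (Ta f \<cdot> st L A u) \<cdot> st L (T A) u)
      = cmp (restr_cat C u) (T A, Ta f \<cdot> st L A u) (restr_ar u (mu L A))"
      by (simp add: restr_cmp_restr_ar)
  qed
  have "monad_laws C L"
    using is_monad by (simp add: is_monad_iff)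
  \<comment> \<open>Only restricted arrows occur in the laws, and \<open>restr_ar u\<close> respects
    identities, composition and the endofunctors; the laws of \<open>L\<close> carry over.\<close>
  then have laws: "monad_laws (restr_cat C u) ?M"
    using u by (simp add: monad_laws_def restr_monad_simps restr_monad_restr_ar restr_ar_cmp
        flip: restr_ar_idn)
  show ?thesis
    unfolding is_monad_iff
  proof (intro conjI ballI)
    fix x assume "x \<in> Ar (restr_cat C u)"
    then obtain A f where "x = (A, f)" "A \<in> Ob C" "f \<in> Ar C" "Dom C f = A \<otimes> ?U"
      by (cases x) auto
    then show "cmp (restr_cat C u) (eta ?M (Cod (restr_cat C u) x)) x
        = cmp (restr_cat C u) (on_ar (endo ?M) x) (eta ?M (Dom (restr_cat C u) x))"
      "cmp (restr_cat C u) (mu ?M (Cod (restr_cat C u) x)) (on_ar (endo ?M) (on_ar (endo ?M) x))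
        = cmp (restr_cat C u) (on_ar (endo ?M) x) (mu ?M (Dom (restr_cat C u) x))"
      using u nat_eta[of A f] nat_mu[of A f]
      by (simp_all add: restr_monad_simps del: restr_cat_simps(6) Ta_simps(6))
  next
    show "eta ?M \<in> extensional (Ob (restr_cat C u))" "mu ?M \<in> extensional (Ob (restr_cat C u))"
      by (simp_all add: restr_monad_def Let_def)
  qed (use u laws in \<open>simp_all add: hom_def restr_monad_simps is_functor_restr_monad\<close>)
qed

text \<open>Units and multiplications are restricted arrows, hence compatible with further
  restriction. On functors, compatibility is \<open>st_idem\<close> for the mediating arrow.\<close>

lemma formal_of_local:
  assumes Z: "Z \<subseteq> central_idempotents C"
  shows "formal_monad (Cbar C Z) (formal_of_local C Z L)"
  unfolding formal_monad_Cbar_iff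
proof (intro conjI ballI impI)
  show "formal_of_local C Z L \<in> extensional Z"
    by (simp add: formal_of_local_def)
  show "is_monad (restr_cat C u) (formal_of_local C Z L u)" if "u \<in> Z" for u
    using that Z by (auto simp: formal_of_local_def is_monad_restr_monad)
next
  fix u v A assume uv: "u \<in> Z" "v \<in> Z" "idem_le C u v" and A: "A \<in> Ob C"
  then have Z: "u \<in> central_idempotents C" "v \<in> central_idempotents C"
    using Z by auto
  let ?M = "formal_of_local C Z L"
  have M: "?M u = restr_monad C L u" "?M v = restr_monad C L v"
    using uv by (simp_all add: formal_of_local_def)
  show "on_ob (endo (?M u)) A = on_ob (endo (?M v)) A"
    "eta (?M u) A = on_ar (restr_functor C u v) (eta (?M v) A)"
    "mu (?M u) A = on_ar (restr_functor C u v) (mu (?M v) A)"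
    using uv A Z by (simp_all add: M restr_monad_simps restr_functor_restr_ar del: restr_functor_simps)
next
  fix u v x assume uv: "u \<in> Z" "v \<in> Z" "idem_le C u v" and x: "x \<in> Ar (restr_cat C v)"
  then have Z: "u \<in> central_idempotents C" "v \<in> central_idempotents C"
    using Z by auto
  let ?M = "formal_of_local C Z L"
  have M: "?M u = restr_monad C L u" "?M v = restr_monad C L v"
    using uv by (simp_all add: formal_of_local_def)
  obtain A f where f: "x = (A, f)" "A \<in> Ob C" "f \<in> Ar C" "Dom C f = A \<otimes> Dom C v"
    using x by (cases x) auto
  obtain m where m: "m \<in> Ar C" "Dom C m = Dom C u" "Cod C m = Dom C v" "v \<cdot> m = u" "idem_arr C u v = m"
    using Z(2) uv(3) by (rule idem_leE)
  have "st L A v \<cdot> (idn C (T A) \<boxtimes> m) = Ta (idn C A \<boxtimes> m) \<cdot> st L A u"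
    using f Z m by (intro st_idem) (simp_all add: hom_def)
  then show "on_ar (endo (?M u)) (on_ar (restr_functor C u v) x) = on_ar (restr_functor C u v) (on_ar (endo (?M v)) x)"
    using f m(1-3,5) Z by (simp add: M restr_monad_simps)
qed

end

text \<open>Associativity of the strength, the one clause of \<open>localisable_monad\<close> that
  is not an assumption of the locale, is the derived \<open>st_assoc\<close>.\<close>

lemma localised_monad_iff:
  assumes "stiff_category C"
  shows "localised_monad C L \<longleftrightarrow> localisable_monad C L"
proof
  assume "localised_monad C L"
  then interpret localised_monad C L .
  show "localisable_monad C L"
    unfolding localisable_monad_def Let_def
    by (intro conjI ballI impI;
        rule is_monad st_extensional st_hom st_unit st_assoc st_eta st_mu st_idem st_natural; assumption)
next
  assume L: "localisable_monad C L"
  interpret stiff_category C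
    by fact
  note 1 = L[unfolded localisable_monad_def Let_def]
  note 2 = 1[THEN conjunct2]
  note 3 = 2[THEN conjunct2]
  note 4 = 3[THEN conjunct2]
  note 5 = 4[THEN conjunct2]
  note 6 = 5[THEN conjunct2, THEN conjunct2]
  note 7 = 6[THEN conjunct2]
  note 8 = 7[THEN conjunct2]
  note 9 = 8[THEN conjunct2]
  note ax = 1[THEN conjunct1] 2[THEN conjunct1] 3[THEN conjunct1, rule_format] 4[THEN conjunct1, rule_format]
    5[THEN conjunct1, rule_format] 6[THEN conjunct1, rule_format] 7[THEN conjunct1, rule_format]
    8[THEN conjunct1, rule_format] 9[rule_format]
  show "localised_monad C L"
    by unfold_locales (rule ax; assumption)+
qed

section \<open>From formal monads to localisable monads\<close>

locale formal_monad_on = stiff_category C for C :: "('o, 'a) smc" (structure) +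
  fixes Z :: "'a set" and M :: "'a \<Rightarrow> ('o, 'o \<times> 'a) monad"
  assumes ZI: "is_ZI C Z"
    and formal: "formal_monad (Cbar C Z) M"
begin

abbreviation top :: 'a where "top \<equiv> idn C \<one>"
abbreviation T :: "'o \<Rightarrow> 'o" where "T \<equiv> on_ob (endo (M top))"
abbreviation Ta :: "'a \<Rightarrow> 'a" where "Ta \<equiv> on_ar (top_functor C M)"
abbreviation str :: "'o \<Rightarrow> 'a \<Rightarrow> 'a" where "str \<equiv> formal_strength C M"

lemma Z_central [simp]: "u \<in> Z \<Longrightarrow> u \<in> central_idempotents C"
  using ZI by (auto simp: is_ZI_def)

lemma top_Z [simp]: "top \<in> Z"
  using ZI by (auto simp: is_ZI_def)

lemma unique_rep: "u \<in> central_idempotents C \<Longrightarrow> \<exists>!z. z \<in> Z \<and> idem_eq C u z"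
  using ZI unfolding is_ZI_def by blast

lemma idem_le_top:
  assumes "u \<in> central_idempotents C"
  shows "idem_le C u top"
  unfolding idem_le_def
  by (rule bexI[of _ u]) (use assms in \<open>simp_all add: hom_def\<close>)

lemma fibre_monad: "u \<in> Z \<Longrightarrow> is_monad (restr_cat C u) (M u)"
  using formal by (simp add: formal_monad_Cbar_iff)

lemma fibre_functor: "u \<in> Z \<Longrightarrow> is_functor (restr_cat C u) (restr_cat C u) (endo (M u))"
  using fibre_monad by (simp add: is_monad_iff)

lemma fibre_restr:
  assumes "u \<in> Z" "v \<in> Z" "idem_le C u v"
  shows "A \<in> Ob C \<Longrightarrow> on_ob (endo (M u)) A = on_ob (endo (M v)) A"
    "A \<in> Ob C \<Longrightarrow> eta (M u) A = on_ar (restr_functor C u v) (eta (M v) A)"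
    "A \<in> Ob C \<Longrightarrow> mu (M u) A = on_ar (restr_functor C u v) (mu (M v) A)"
    "x \<in> Ar (restr_cat C v) \<Longrightarrow> on_ar (endo (M u)) (on_ar (restr_functor C u v) x)
      = on_ar (restr_functor C u v) (on_ar (endo (M v)) x)"
  using formal assms unfolding formal_monad_Cbar_iff by blast+

lemma on_ob_fibre: "u \<in> Z \<Longrightarrow> A \<in> Ob C \<Longrightarrow> on_ob (endo (M u)) A = T A"
  by (intro fibre_restr idem_le_top) simp_all

lemma T_Ob [simp]: "A \<in> Ob C \<Longrightarrow> T A \<in> Ob C"
  using is_functorD(3)[OF fibre_functor[OF top_Z]] by simp

lemma Ta_conv: "f \<in> Ar C \<Longrightarrow> Ta f = from_top C (on_ar (endo (M top)) (restr_ar top f))"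
  by (simp add: top_functor_def Let_def to_top_conv)

lemma Ta_ar [simp]:
  assumes "f \<in> Ar C"
  shows "Ta f \<in> Ar C" "Dom C (Ta f) = T (Dom C f)" "Cod C (Ta f) = T (Cod C f)"
    "on_ar (endo (M top)) (restr_ar top f) = restr_ar top (Ta f)"
  using assms is_functorD(4-6)[OF fibre_functor[OF top_Z], of "restr_ar top f"]
  by (simp_all add: Ta_conv)

text \<open>A restricted arrow comes from the top fibre along \<open>u \<le> 1\<close>, and the
  components of a formal monad commute with that restriction.\<close>

lemma on_ar_fibre_restr_ar:
  assumes u: "u \<in> Z" and f: "f \<in> Ar C"
  shows "on_ar (endo (M u)) (restr_ar u f) = restr_ar u (Ta f)"
proof -
  have le: "idem_le C u top"
    using u by (simp add: idem_le_top)
  have "on_ar (endo (M u)) (restr_ar u f)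
    = on_ar (endo (M u)) (on_ar (restr_functor C u top) (restr_ar top f))"
    using u f le by (simp add: restr_functor_restr_ar)
  also have "\<dots> = on_ar (restr_functor C u top) (on_ar (endo (M top)) (restr_ar top f))"
    using u f le by (intro fibre_restr) simp_all
  also have "\<dots> = restr_ar u (Ta f)"
    using u f le by (simp add: restr_functor_restr_ar)
  finally show ?thesis .
qed

definition eta_top :: "'o \<Rightarrow> 'a" where "eta_top A = from_top C (eta (M top) A)"
definition mu_top :: "'o \<Rightarrow> 'a" where "mu_top A = from_top C (mu (M top) A)"

lemma eta_mu_top [simp]:
  assumes "A \<in> Ob C"
  shows "eta_top A \<in> Ar C" "Dom C (eta_top A) = A" "Cod C (eta_top A) = T A"
    "mu_top A \<in> Ar C" "Dom C (mu_top A) = T (T A)" "Cod C (mu_top A) = T A"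
    "eta (M top) A = restr_ar top (eta_top A)" "mu (M top) A = restr_ar top (mu_top A)"
proof -
  have "eta (M top) A \<in> hom (restr_cat C top) A (T A)" "mu (M top) A \<in> hom (restr_cat C top) (T (T A)) (T A)"
    using fibre_monad[OF top_Z] assms by (auto simp: is_monad_iff)
  then show "eta_top A \<in> Ar C" "Dom C (eta_top A) = A" "Cod C (eta_top A) = T A"
    "mu_top A \<in> Ar C" "Dom C (mu_top A) = T (T A)" "Cod C (mu_top A) = T A"
    "eta (M top) A = restr_ar top (eta_top A)" "mu (M top) A = restr_ar top (mu_top A)"
    by (simp_all add: eta_top_def mu_top_def hom_def)
qed

lemma eta_mu_fibre:
  assumes "u \<in> Z" "A \<in> Ob C"
  shows "eta (M u) A = restr_ar u (eta_top A)" "mu (M u) A = restr_ar u (mu_top A)"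
  using assms fibre_restr(2,3)[OF assms(1) top_Z idem_le_top assms(2)]
  by (simp_all add: restr_functor_restr_ar idem_le_top)

lemma fibre_natural:
  assumes u: "u \<in> Z" and x: "x \<in> Ar (restr_cat C u)"
  shows "cmp (restr_cat C u) (eta (M u) (Cod (restr_cat C u) x)) x
      = cmp (restr_cat C u) (on_ar (endo (M u)) x) (eta (M u) (Dom (restr_cat C u) x))"
    "cmp (restr_cat C u) (mu (M u) (Cod (restr_cat C u) x)) (on_ar (endo (M u)) (on_ar (endo (M u)) x))
      = cmp (restr_cat C u) (on_ar (endo (M u)) x) (mu (M u) (Dom (restr_cat C u) x))"
  using fibre_monad[OF u] x by (simp_all add: is_monad_iff)

text \<open>The functor laws of the top component, read back in C along
  \<open>restr_ar_top_inject\<close>.\<close>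

lemma is_functor_top_functor: "is_functor C C (top_functor C M)"
proof -
  have ob: "on_ob (top_functor C M) = (\<lambda>A\<in>Ob C. T A)"
    by (simp add: top_functor_def Let_def)
  have "Ta (idn C A) = idn C (T A)" if "A \<in> Ob C" for A
  proof (rule restr_ar_top_inject)
    show "restr_ar top (Ta (idn C A)) = restr_ar top (idn C (T A))"
      using that is_functorD(7)[OF fibre_functor[OF top_Z], of A]
      by (simp add: restr_ar_idn flip: Ta_ar(4))
  qed (use that in simp_all)
  moreover have "Ta (g \<cdot> f) = Ta g \<cdot> Ta f" if f: "f \<in> Ar C" and g: "g \<in> Ar C" "Cod C f = Dom C g" for f g
  proof (rule restr_ar_top_inject)
    have "restr_ar top (Ta (g \<cdot> f)) = on_ar (endo (M top)) (cmp (restr_cat C top) (restr_ar top g) (restr_ar top f))"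
      using f g by (simp add: restr_ar_cmp)
    also have "\<dots> = cmp (restr_cat C top) (on_ar (endo (M top)) (restr_ar top g)) (on_ar (endo (M top)) (restr_ar top f))"
      using f g by (intro is_functorD(8)[OF fibre_functor]) simp_all
    finally show "restr_ar top (Ta (g \<cdot> f)) = restr_ar top (Ta g \<cdot> Ta f)"
      using f g by (simp add: restr_ar_cmp)
  qed (use f g in simp_all)
  moreover have "on_ar (top_functor C M) \<in> extensional (Ar C)"
    by (simp add: top_functor_def Let_def)
  ultimately show ?thesis
    unfolding is_functor_def ob by (auto simp: PiE_iff)
qed

lemmas Ta_functor [simp] = is_functorD(7,8)[OF is_functor_top_functor]

lemma on_ob_top_functor [simp]: "A \<in> Ob C \<Longrightarrow> on_ob (top_functor C M) A = T A"
  by (simp add: top_functor_def Let_def)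

lemma top_monad_natural:
  assumes f: "f \<in> Ar C"
  shows "eta_top (Cod C f) \<cdot> f = Ta f \<cdot> eta_top (Dom C f)"
    "mu_top (Cod C f) \<cdot> Ta (Ta f) = Ta f \<cdot> mu_top (Dom C f)"
proof -
  have "restr_ar top (eta_top (Cod C f) \<cdot> f) = restr_ar top (Ta f \<cdot> eta_top (Dom C f))"
    using fibre_natural(1)[OF top_Z, of "restr_ar top f"] f by (simp add: restr_ar_cmp)
  then show "eta_top (Cod C f) \<cdot> f = Ta f \<cdot> eta_top (Dom C f)"
    by (rule restr_ar_top_inject[rotated -1]) (use f in simp_all)
  have "restr_ar top (mu_top (Cod C f) \<cdot> Ta (Ta f)) = restr_ar top (Ta f \<cdot> mu_top (Dom C f))"
    using fibre_natural(2)[OF top_Z, of "restr_ar top f"] f by (simp add: restr_ar_cmp)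
  then show "mu_top (Cod C f) \<cdot> Ta (Ta f) = Ta f \<cdot> mu_top (Dom C f)"
    by (rule restr_ar_top_inject[rotated -1]) (use f in simp_all)
qed

lemma top_monad_laws:
  assumes A: "A \<in> Ob C"
  shows "mu_top A \<cdot> eta_top (T A) = idn C (T A)" "mu_top A \<cdot> Ta (eta_top A) = idn C (T A)"
    "mu_top A \<cdot> mu_top (T A) = mu_top A \<cdot> Ta (mu_top A)"
proof -
  have "monad_laws (restr_cat C top) (M top)"
    using fibre_monad[OF top_Z] by (simp add: is_monad_iff)
  then have eqs: "restr_ar top (mu_top A \<cdot> eta_top (T A)) = restr_ar top (idn C (T A))
    \<and> restr_ar top (mu_top A \<cdot> Ta (eta_top A)) = restr_ar top (idn C (T A))
    \<and> restr_ar top (mu_top A \<cdot> mu_top (T A)) = restr_ar top (mu_top A \<cdot> Ta (mu_top A))"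
    using A by (simp add: monad_laws_def restr_ar_cmp flip: restr_ar_idn)
  show "mu_top A \<cdot> eta_top (T A) = idn C (T A)" "mu_top A \<cdot> Ta (eta_top A) = idn C (T A)"
    "mu_top A \<cdot> mu_top (T A) = mu_top A \<cdot> Ta (mu_top A)"
    by (rule restr_ar_top_inject; use A eqs in simp)+
qed

text \<open>The pair \<open>(A, idn C (A \<otimes> Dom C u))\<close> is the unit of the adjunction.
  Applying the left adjoint and then the counit is transposition, which here leaves the underlying
  arrow unchanged, so the strength is simply the image of the unit under the component at
  \<open>u\<close>.\<close>

lemma str:
  assumes A: "A \<in> Ob C" and u: "u \<in> Z"
  shows "str A u \<in> Ar C" "Dom C (str A u) = T A \<otimes> Dom C u" "Cod C (str A u) = T (A \<otimes> Dom C u)"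
    "on_ar (endo (M u)) (A, idn C (A \<otimes> Dom C u)) = (T A, str A u)"
proof -
  let ?U = "Dom C u" and ?x = "(A, idn C (A \<otimes> Dom C u))"
  have x: "?x \<in> Ar (restr_cat C u)"
    using A u by simp
  obtain B s where y: "on_ar (endo (M u)) ?x = (B, s)"
    by (cases "on_ar (endo (M u)) ?x")
  have "B = T A" and s: "s \<in> Ar C" "Dom C s = T A \<otimes> ?U" "Cod C s = T (A \<otimes> ?U)"
    using is_functorD(4-6)[OF fibre_functor[OF u] x] A u by (simp_all add: y on_ob_fibre[OF u])
  let ?d = "inv_ar C (proj C (T A \<otimes> ?U) u)"
  have F: "on_ar (ext_functor C u top) (T A, s) = (T A \<otimes> ?U, (s \<boxtimes> idn C ?U) \<cdot> (?d \<cdot> runit C (T A \<otimes> ?U)))"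
    using A u s by (simp add: ext_functor_def proj_idn_uni proj_tens)
  have o: "on_ob (ext_functor C u top) A = A \<otimes> ?U"
    using A by (simp add: ext_functor_def)
  have e: "adj_counit C u top (T (A \<otimes> ?U)) = restr_ar top (proj C (T (A \<otimes> ?U)) u)"
    using A u by (simp add: adj_counit_def restr_ar_def)
  have "str A u = from_top C (cmp (restr_cat C top) (restr_ar top (proj C (T (A \<otimes> ?U)) u))
      (T A \<otimes> ?U, (s \<boxtimes> idn C ?U) \<cdot> (?d \<cdot> runit C (T A \<otimes> ?U))))"
    using A u by (simp add: formal_strength_def Let_def adj_unit_def o y \<open>B = T A\<close> F e)
  \<comment> \<open>The counit is a restricted arrow, so composition with it happens in C, and
    \<open>from_top\<close> cancels the right unitor.\<close>
  also have "\<dots> = (proj C (T (A \<otimes> ?U)) u \<cdot> (s \<boxtimes> idn C ?U)) \<cdot> ?d"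
    using A u s by (simp add: restr_cmp_restr_ar from_top_def del: restr_cat_simps(6))
  also have "\<dots> = s"
    using A u s by (simp add: proj_natural)
  finally have "str A u = s" .
  with s y \<open>B = T A\<close> show "str A u \<in> Ar C" "Dom C (str A u) = T A \<otimes> ?U" "Cod C (str A u) = T (A \<otimes> ?U)"
    "on_ar (endo (M u)) ?x = (T A, str A u)"
    by simp_all
qed

declare str(1-3) [simp]

text \<open>Functoriality applied to the factorisation of \<open>(A, f)\<close> as the restriction
  of \<open>f\<close> after the adjunction unit.\<close>

lemma on_ar_fibre:
  assumes A: "A \<in> Ob C" and u: "u \<in> Z" and f: "f \<in> Ar C" "Dom C f = A \<otimes> Dom C u"
  shows "on_ar (endo (M u)) (A, f) = (T A, Ta f \<cdot> str A u)"
proof -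
  let ?x = "(A, idn C (A \<otimes> Dom C u))"
  have "(A, f) = cmp (restr_cat C u) (restr_ar u f) ?x"
    using A u f by (simp add: restr_cmp_restr_ar del: restr_cat_simps(6))
  also have "on_ar (endo (M u)) \<dots>
    = cmp (restr_cat C u) (on_ar (endo (M u)) (restr_ar u f)) (on_ar (endo (M u)) ?x)"
    using A u f by (intro is_functorD(8)[OF fibre_functor]) simp_all
  also have "\<dots> = cmp (restr_cat C u) (restr_ar u (Ta f)) (T A, str A u)"
    using A u f by (simp only: on_ar_fibre_restr_ar str(4))
  also have "\<dots> = (T A, Ta f \<cdot> str A u)"
    using A u f by (intro restr_cmp_restr_ar) simp_all
  finally show ?thesis .
qed

text \<open>The right unitor represents the identity of \<open>A\<close> in the top fibre; its image
  is computed once by \<open>on_ar_fibre\<close> and once as an identity.\<close>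

lemma str_unit:
  assumes A: "A \<in> Ob C"
  shows "Ta (runit C A) \<cdot> str A top = runit C (T A)"
proof -
  have "on_ar (endo (M top)) (A, runit C A) = on_ar (endo (M top)) (restr_ar top (idn C A))"
    using A by (simp add: restr_ar_idn proj_idn_uni del: Ta_ar)
  also have "\<dots> = restr_ar top (idn C (T A))"
    using A by simp
  finally show ?thesis
    using A by (simp add: on_ar_fibre restr_ar_idn proj_idn_uni)
qed

text \<open>Naturality of the unit and multiplication in the fibre at \<open>u\<close>, taken at the
  adjunction unit \<open>?x\<close>.\<close>

lemma str_eta_mu:
  assumes A: "A \<in> Ob C" and u: "u \<in> Z"
  shows "eta_top (A \<otimes> Dom C u) = str A u \<cdot> (eta_top A \<boxtimes> idn C (Dom C u))"
    "mu_top (A \<otimes> Dom C u) \<cdot> (Ta (str A u) \<cdot> str (T A) u) = str A u \<cdot> (mu_top A \<boxtimes> idn C (Dom C u))"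
proof -
  let ?x = "(A, idn C (A \<otimes> Dom C u))"
  have x: "?x \<in> Ar (restr_cat C u)"
    using A u by simp
  show "eta_top (A \<otimes> Dom C u) = str A u \<cdot> (eta_top A \<boxtimes> idn C (Dom C u))"
    using fibre_natural(1)[OF u x] A u
    by (simp add: str(4) eta_mu_fibre[OF u] restr_cmp_restr_ar del: restr_cat_simps(6))
  show "mu_top (A \<otimes> Dom C u) \<cdot> (Ta (str A u) \<cdot> str (T A) u) = str A u \<cdot> (mu_top A \<boxtimes> idn C (Dom C u))"
    using fibre_natural(2)[OF u x] A u
    by (simp add: str(4) on_ar_fibre eta_mu_fibre[OF u] restr_cmp_restr_ar del: restr_cat_simps(6))
qed

text \<open>Compatibility with restriction, taken at the adjunction unit of \<open>v\<close>;
  restricted to \<open>u\<close>, that arrow has underlying arrow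
  \<open>idn C A \<boxtimes> m\<close>.\<close>

lemma str_idem:
  assumes A: "A \<in> Ob C" and u: "u \<in> Z" and v: "v \<in> Z"
    and m: "m \<in> Ar C" "Dom C m = Dom C u" "Cod C m = Dom C v" "v \<cdot> m = u"
  shows "str A v \<cdot> (idn C (T A) \<boxtimes> m) = Ta (idn C A \<boxtimes> m) \<cdot> str A u"
proof -
  let ?x = "(A, idn C (A \<otimes> Dom C v))"
  have "m \<in> hom C (Dom C u) (Dom C v)"
    using m by (simp add: hom_def)
  then have le: "idem_le C u v" and i: "idem_arr C u v = m"
    unfolding idem_le_def using m(4)[symmetric] idem_arr_eqI[OF Z_central[OF v]] by blast+
  have "on_ar (endo (M u)) (on_ar (restr_functor C u v) ?x) = on_ar (restr_functor C u v) (on_ar (endo (M v)) ?x)"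
    using A v by (intro fibre_restr[OF u v le]) simp
  then show ?thesis
    using A u v m(1-3) by (simp add: i str(4)[OF A v] on_ar_fibre[OF A u])
qed

text \<open>In the fibre, \<open>f \<boxtimes> idn C (Dom C u)\<close> is the adjunction unit at the
  codomain of \<open>f\<close> after the restriction of \<open>f\<close>. Its image is computed from
  this composite and also by \<open>on_ar_fibre\<close>.\<close>

lemma str_natural:
  assumes f: "f \<in> Ar C" and u: "u \<in> Z"
  shows "str (Cod C f) u \<cdot> (Ta f \<boxtimes> idn C (Dom C u)) = Ta (f \<boxtimes> idn C (Dom C u)) \<cdot> str (Dom C f) u"
proof -
  let ?U = "Dom C u" and ?B = "Cod C f"
  let ?x = "(?B, idn C (?B \<otimes> ?U))"
  have "(Dom C f, f \<boxtimes> idn C ?U) = cmp (restr_cat C u) ?x (restr_ar u f)"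
    using f u by (simp add: restr_cmp_restr_ar del: restr_cat_simps(6))
  then have "on_ar (endo (M u)) (Dom C f, f \<boxtimes> idn C ?U)
    = cmp (restr_cat C u) (on_ar (endo (M u)) ?x) (on_ar (endo (M u)) (restr_ar u f))"
    using f u is_functorD(8)[OF fibre_functor[OF u], of "restr_ar u f" ?x] by (simp del: restr_cat_simps(6))
  then show ?thesis
    using f u by (simp add: str(4) on_ar_fibre on_ar_fibre_restr_ar restr_cmp_restr_ar del: restr_cat_simps(6))
qed

section \<open>The localisable monad obtained from a formal monad\<close>

abbreviation L :: "('o, 'a) lmonad" where "L \<equiv> local_of_formal C Z M"

lemma local_of_formal_simps [simp]:
  "endo L = top_functor C M"
  "A \<in> Ob C \<Longrightarrow> eta L A = eta_top A"
  "A \<in> Ob C \<Longrightarrow> mu L A = mu_top A"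
  by (simp_all add: local_of_formal_def Let_def eta_top_def mu_top_def del: eta_mu_top)

lemma is_iso_Ta [simp]: "is_iso C f \<Longrightarrow> is_iso C (Ta f)"
  by (rule functor_is_iso[OF is_functor_top_functor])

lemma idem_rep_Z:
  assumes u: "u \<in> Z"
  shows "idem_rep C Z u = u"
proof -
  have "idem_eq C u u"
    unfolding idem_eq_def using u by (intro bexI[of _ "idn C (Dom C u)"]) (simp_all add: hom_def)
  moreover have "\<exists>!z. z \<in> Z \<and> idem_eq C u z"
    using u by (intro unique_rep) simp
  ultimately show ?thesis
    unfolding idem_rep_def using u by (intro the1_equality conjI)
qed

lemma st_local_of_formal_rep:
  assumes u: "u \<in> central_idempotents C"
  obtains z m where "z \<in> Z" "is_iso C m" "m \<in> Ar C" "Dom C m = Dom C u" "Cod C m = Dom C z" "z \<cdot> m = u"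
    "\<And>A. A \<in> Ob C \<Longrightarrow> st L A u = inv_ar C (Ta (idn C A \<boxtimes> m)) \<cdot> (str A z \<cdot> (idn C (T A) \<boxtimes> m))"
proof -
  let ?z = "idem_rep C Z u"
  have "\<exists>!z. z \<in> Z \<and> idem_eq C u z"
    using u by (rule unique_rep)
  then have "?z \<in> Z \<and> idem_eq C u ?z"
    unfolding idem_rep_def by (rule theI')
  then have z: "?z \<in> Z" and "idem_eq C u ?z"
    by auto
  then obtain m where m: "m \<in> hom C (Dom C u) (Dom C ?z)" "is_iso C m" "u = ?z \<cdot> m"
    unfolding idem_eq_def by blast
  have "idem_arr C u ?z = m"
    by (rule idem_arr_eqI[OF _ m(1,3)]) (simp add: z)
  then have "st L A u = inv_ar C (Ta (idn C A \<boxtimes> m)) \<cdot> (str A ?z \<cdot> (idn C (T A) \<boxtimes> m))" if "A \<in> Ob C" for A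
    using that u by (simp add: local_of_formal_def Let_def)
  then show thesis
    using z m(1,2) m(3)[symmetric] by (intro that[of ?z m]) (simp_all add: hom_def)
qed

text \<open>A member of \<open>Z\<close> represents itself, and the mediating arrow is the identity,
  so the transport is trivial.\<close>

lemma st_local_of_formal:
  assumes A: "A \<in> Ob C" and u: "u \<in> Z"
  shows "st L A u = str A u"
proof -
  have "idem_arr C u u = idn C (Dom C u)"
    using u by (intro idem_arr_eqI) (simp_all add: hom_def)
  then show ?thesis
    using A u by (simp add: local_of_formal_def Let_def idem_rep_Z)
qed

lemma st_local_of_formal_ar [simp]:
  assumes A: "A \<in> Ob C" and u: "u \<in> central_idempotents C"
  shows "st L A u \<in> Ar C" "Dom C (st L A u) = T A \<otimes> Dom C u" "Cod C (st L A u) = T (A \<otimes> Dom C u)"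
proof -
  obtain z m where "z \<in> Z" "is_iso C m" "m \<in> Ar C" "Dom C m = Dom C u" "Cod C m = Dom C z"
    and "st L A u = inv_ar C (Ta (idn C A \<boxtimes> m)) \<cdot> (str A z \<cdot> (idn C (T A) \<boxtimes> m))"
    using st_local_of_formal_rep[OF u] A by metis
  with A u show "st L A u \<in> Ar C" "Dom C (st L A u) = T A \<otimes> Dom C u"
    "Cod C (st L A u) = T (A \<otimes> Dom C u)"
    by simp_all
qed

text \<open>The transport without inverses. As \<open>Ta (idn C A \<boxtimes> m)\<close> is
  invertible, each axiom at \<open>u\<close> is proved below by composing with it, using the axiom
  at the representative \<open>z\<close>, and cancelling.\<close>

lemma st_local_of_formalE:
  assumes u: "u \<in> central_idempotents C"
  obtains z m where "z \<in> Z" "is_iso C m" "m \<in> Ar C" "Dom C m = Dom C u" "Cod C m = Dom C z" "z \<cdot> m = u"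
    "\<And>A. A \<in> Ob C \<Longrightarrow> Ta (idn C A \<boxtimes> m) \<cdot> st L A u = str A z \<cdot> (idn C (T A) \<boxtimes> m)"
proof -
  obtain z m where zm: "z \<in> Z" "is_iso C m" "m \<in> Ar C" "Dom C m = Dom C u" "Cod C m = Dom C z" "z \<cdot> m = u"
    and st: "\<And>A. A \<in> Ob C \<Longrightarrow> st L A u = inv_ar C (Ta (idn C A \<boxtimes> m)) \<cdot> (str A z \<cdot> (idn C (T A) \<boxtimes> m))"
    using st_local_of_formal_rep[OF u] by metis
  have "Ta (idn C A \<boxtimes> m) \<cdot> st L A u = str A z \<cdot> (idn C (T A) \<boxtimes> m)" if "A \<in> Ob C" for A
    using that zm(1-5) by (simp add: st)
  then show thesis
    using zm by (intro that)
qed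

lemma is_monad_local_of_formal: "is_monad C L"
  unfolding is_monad_iff
proof (intro conjI ballI)
  show "eta L \<in> extensional (Ob C)" "mu L \<in> extensional (Ob C)"
    by (simp_all add: local_of_formal_def Let_def)
  show "monad_laws C L"
    unfolding monad_laws_def by (simp add: top_monad_laws)
qed (simp_all add: is_functor_top_functor hom_def top_monad_natural)

text \<open>Naturality of \<open>eta_top\<close> and \<open>mu_top\<close> at
  \<open>idn C A \<boxtimes> m\<close> carries both equations to \<open>z\<close>, where
  \<open>str_eta_mu\<close> applies.\<close>

lemma st_eta_mu_local_of_formal:
  assumes A: "A \<in> Ob C" and u: "u \<in> central_idempotents C"
  shows "eta_top (A \<otimes> Dom C u) = st L A u \<cdot> (eta_top A \<boxtimes> idn C (Dom C u))"
    "mu_top (A \<otimes> Dom C u) \<cdot> (Ta (st L A u) \<cdot> st L (T A) u) = st L A u \<cdot> (mu_top A \<boxtimes> idn C (Dom C u))"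
proof -
  obtain z m where z: "z \<in> Z" and m: "is_iso C m" "m \<in> Ar C" "Dom C m = Dom C u" "Cod C m = Dom C z"
    and st: "\<And>A. A \<in> Ob C \<Longrightarrow> Ta (idn C A \<boxtimes> m) \<cdot> st L A u = str A z \<cdot> (idn C (T A) \<boxtimes> m)"
    using st_local_of_formalE[OF u] by blast
  note [simp] = A u z m
  let ?U = "Dom C u" and ?W = "Dom C z" and ?e = "Ta (idn C A \<boxtimes> m)"
  have o [simp]: "?U \<in> Ob C" "?W \<in> Ob C"
    by (simp_all add: u)
  have "?e \<cdot> eta_top (A \<otimes> ?U) = eta_top (A \<otimes> ?W) \<cdot> (idn C A \<boxtimes> m)"
    using top_monad_natural(1)[of "idn C A \<boxtimes> m"] by simp
  also have "\<dots> = (str A z \<cdot> (idn C (T A) \<boxtimes> m)) \<cdot> (eta_top A \<boxtimes> idn C ?U)"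
    by (simp add: str_eta_mu(1))
  also have "\<dots> = ?e \<cdot> (st L A u \<cdot> (eta_top A \<boxtimes> idn C ?U))"
    by (simp flip: st)
  finally show "eta_top (A \<otimes> ?U) = st L A u \<cdot> (eta_top A \<boxtimes> idn C ?U)"
    by (rule iso_monic[rotated -1]) simp_all
  have e: "?e \<cdot> mu_top (A \<otimes> ?U) = mu_top (A \<otimes> ?W) \<cdot> Ta ?e"
    using top_monad_natural(2)[of "idn C A \<boxtimes> m"] by simp
  have "?e \<cdot> (mu_top (A \<otimes> ?U) \<cdot> (Ta (st L A u) \<cdot> st L (T A) u))
    = (?e \<cdot> mu_top (A \<otimes> ?U)) \<cdot> (Ta (st L A u) \<cdot> st L (T A) u)"
    by simp
  also have "\<dots> = mu_top (A \<otimes> ?W) \<cdot> ((Ta ?e \<cdot> Ta (st L A u)) \<cdot> st L (T A) u)"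
    unfolding e by simp
  also have "Ta ?e \<cdot> Ta (st L A u) = Ta (str A z) \<cdot> Ta (idn C (T A) \<boxtimes> m)"
    by (simp add: st flip: Ta_functor(2))
  also have "mu_top (A \<otimes> ?W) \<cdot> ((Ta (str A z) \<cdot> Ta (idn C (T A) \<boxtimes> m)) \<cdot> st L (T A) u)
    = mu_top (A \<otimes> ?W) \<cdot> (Ta (str A z) \<cdot> (Ta (idn C (T A) \<boxtimes> m) \<cdot> st L (T A) u))"
    by simp
  also have "\<dots> = (mu_top (A \<otimes> ?W) \<cdot> (Ta (str A z) \<cdot> str (T A) z)) \<cdot> (idn C (T (T A)) \<boxtimes> m)"
    by (simp add: st)
  also have "\<dots> = (str A z \<cdot> (idn C (T A) \<boxtimes> m)) \<cdot> (mu_top A \<boxtimes> idn C ?U)"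
    by (subst str_eta_mu(2)) simp_all
  also have "\<dots> = ?e \<cdot> (st L A u \<cdot> (mu_top A \<boxtimes> idn C ?U))"
    by (simp flip: st)
  finally show "mu_top (A \<otimes> ?U) \<cdot> (Ta (st L A u) \<cdot> st L (T A) u) = st L A u \<cdot> (mu_top A \<boxtimes> idn C ?U)"
    by (rule iso_monic[rotated -1]) simp_all
qed

lemma st_idem_local_of_formal:
  assumes A: "A \<in> Ob C" and u: "u \<in> central_idempotents C" and v: "v \<in> central_idempotents C"
    and n: "n \<in> Ar C" "Dom C n = Dom C u" "Cod C n = Dom C v" "v \<cdot> n = u"
  shows "st L A v \<cdot> (idn C (T A) \<boxtimes> n) = Ta (idn C A \<boxtimes> n) \<cdot> st L A u"
proof -
  obtain z m where z: "z \<in> Z" and m: "is_iso C m" "m \<in> Ar C" "Dom C m = Dom C u" "Cod C m = Dom C z" "z \<cdot> m = u"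
    and stu: "\<And>A. A \<in> Ob C \<Longrightarrow> Ta (idn C A \<boxtimes> m) \<cdot> st L A u = str A z \<cdot> (idn C (T A) \<boxtimes> m)"
    using st_local_of_formalE[OF u] by blast
  obtain w k where w: "w \<in> Z" and k: "is_iso C k" "k \<in> Ar C" "Dom C k = Dom C v" "Cod C k = Dom C w" "w \<cdot> k = v"
    and stv: "\<And>A. A \<in> Ob C \<Longrightarrow> Ta (idn C A \<boxtimes> k) \<cdot> st L A v = str A w \<cdot> (idn C (T A) \<boxtimes> k)"
    using st_local_of_formalE[OF v] by blast
  note [simp] = A u v n(1-3) z m(1-4) w k(1-4)
  \<comment> \<open>The arrow \<open>n\<close> transported to the representatives; it witnesses
    \<open>z \<le> w\<close>, so \<open>str_idem\<close> applies.\<close>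
  define q where "q = k \<cdot> (n \<cdot> inv_ar C m)"
  have q [simp]: "q \<in> Ar C" "Dom C q = Dom C z" "Cod C q = Dom C w"
    by (simp_all add: q_def)
  have qm: "q \<cdot> m = k \<cdot> n"
    by (simp add: q_def)
  have "w \<cdot> q = (w \<cdot> k) \<cdot> (n \<cdot> inv_ar C m)"
    by (simp add: q_def)
  also have "\<dots> = (v \<cdot> n) \<cdot> inv_ar C m"
    unfolding k(5) by simp
  also have "\<dots> = (z \<cdot> m) \<cdot> inv_ar C m"
    by (simp only: n(4) m(5))
  finally have wq: "w \<cdot> q = z"
    by simp
  have "Ta (idn C A \<boxtimes> k) \<cdot> (st L A v \<cdot> (idn C (T A) \<boxtimes> n))
    = (Ta (idn C A \<boxtimes> k) \<cdot> st L A v) \<cdot> (idn C (T A) \<boxtimes> n)"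
    by (subst cmp_assoc_right) simp_all
  also have "\<dots> = (str A w \<cdot> (idn C (T A) \<boxtimes> q)) \<cdot> (idn C (T A) \<boxtimes> m)"
    by (simp add: stv qm)
  also have "\<dots> = Ta (idn C A \<boxtimes> q) \<cdot> (str A z \<cdot> (idn C (T A) \<boxtimes> m))"
    using str_idem[OF A z w q wq] by simp
  also have "\<dots> = (Ta (idn C A \<boxtimes> q) \<cdot> Ta (idn C A \<boxtimes> m)) \<cdot> st L A u"
    by (simp flip: stu)
  also have "Ta (idn C A \<boxtimes> q) \<cdot> Ta (idn C A \<boxtimes> m) = Ta (idn C A \<boxtimes> k) \<cdot> Ta (idn C A \<boxtimes> n)"
    by (simp add: qm flip: Ta_functor(2))
  finally have "Ta (idn C A \<boxtimes> k) \<cdot> (st L A v \<cdot> (idn C (T A) \<boxtimes> n))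
    = Ta (idn C A \<boxtimes> k) \<cdot> (Ta (idn C A \<boxtimes> n) \<cdot> st L A u)"
    by simp
  then show ?thesis
    by (rule iso_monic[rotated -1]) simp_all
qed

lemma st_natural_local_of_formal:
  assumes f: "f \<in> Ar C" and u: "u \<in> central_idempotents C"
  shows "st L (Cod C f) u \<cdot> (Ta f \<boxtimes> idn C (Dom C u)) = Ta (f \<boxtimes> idn C (Dom C u)) \<cdot> st L (Dom C f) u"
proof -
  obtain z m where z: "z \<in> Z" and m: "is_iso C m" "m \<in> Ar C" "Dom C m = Dom C u" "Cod C m = Dom C z"
    and st: "\<And>A. A \<in> Ob C \<Longrightarrow> Ta (idn C A \<boxtimes> m) \<cdot> st L A u = str A z \<cdot> (idn C (T A) \<boxtimes> m)"
    using st_local_of_formalE[OF u] by blast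
  note [simp] = f u z m
  let ?A = "Dom C f" and ?B = "Cod C f" and ?U = "Dom C u" and ?W = "Dom C z"
  have "Ta (idn C ?B \<boxtimes> m) \<cdot> (st L ?B u \<cdot> (Ta f \<boxtimes> idn C ?U))
    = (Ta (idn C ?B \<boxtimes> m) \<cdot> st L ?B u) \<cdot> (Ta f \<boxtimes> idn C ?U)"
    by (subst cmp_assoc_right) simp_all
  also have "\<dots> = (str ?B z \<cdot> (Ta f \<boxtimes> idn C ?W)) \<cdot> (idn C (T ?A) \<boxtimes> m)"
    by (simp add: st)
  also have "\<dots> = Ta (f \<boxtimes> idn C ?W) \<cdot> (str ?A z \<cdot> (idn C (T ?A) \<boxtimes> m))"
    by (simp add: str_natural)
  also have "\<dots> = (Ta (f \<boxtimes> idn C ?W) \<cdot> Ta (idn C ?A \<boxtimes> m)) \<cdot> st L ?A u"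
    by (simp flip: st)
  also have "Ta (f \<boxtimes> idn C ?W) \<cdot> Ta (idn C ?A \<boxtimes> m) = Ta (idn C ?B \<boxtimes> m) \<cdot> Ta (f \<boxtimes> idn C ?U)"
    by (simp flip: Ta_functor(2))
  finally have "Ta (idn C ?B \<boxtimes> m) \<cdot> (st L ?B u \<cdot> (Ta f \<boxtimes> idn C ?U))
    = Ta (idn C ?B \<boxtimes> m) \<cdot> (Ta (f \<boxtimes> idn C ?U) \<cdot> st L ?A u)"
    by simp
  then show ?thesis
    by (rule iso_monic[rotated -1]) simp_all
qed

lemma localised_monad_local_of_formal: "localised_monad C L"
proof (intro localised_monad.intro localised_monad_axioms.intro stiff_category_axioms)
  show "is_monad C L"
    by (rule is_monad_local_of_formal)
  show "st L \<in> extensional (Ob C)"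
    by (simp add: local_of_formal_def Let_def)
  show "st L A \<in> extensional (central_idempotents C)" if "A \<in> Ob C" for A
    using that by (simp add: local_of_formal_def Let_def)
  show "on_ar (endo L) (runit C A) \<cdot> st L A (idn C \<one>) = runit C (on_ob (endo L) A)" if "A \<in> Ob C" for A
    using that by (simp add: st_local_of_formal str_unit)
  show "st L A v \<cdot> (idn C (on_ob (endo L) A) \<boxtimes> m) = on_ar (endo L) (idn C A \<boxtimes> m) \<cdot> st L A u"
    if "A \<in> Ob C" "u \<in> central_idempotents C" "v \<in> central_idempotents C"
      "m \<in> hom C (Dom C u) (Dom C v)" "u = v \<cdot> m" for A u v m
  proof -
    have "m \<in> Ar C" "Dom C m = Dom C u" "Cod C m = Dom C v"
      using that(4) by (simp_all add: hom_def)
    from st_idem_local_of_formal[OF that(1-3) this that(5)[symmetric]] that(1) show ?thesis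
      by simp
  qed
qed (simp_all add: hom_def st_eta_mu_local_of_formal st_natural_local_of_formal)

text \<open>All data are extensional, so it suffices to compare them on carriers. The case of arrows
  is \<open>on_ar_fibre\<close>: each component is recovered from the top one and the
  strength.\<close>

lemma formal_of_local_of_formal: "formal_of_local C Z L = M"
proof (rule ext)
  interpret L: localised_monad C L
    by (rule localised_monad_local_of_formal)
  fix u
  show "formal_of_local C Z L u = M u"
  proof (cases "u \<in> Z")
    \<comment> \<open>Outside \<open>Z\<close> both families take the default value
      \<open>undefined\<close>.\<close>
    case False
    have "M \<in> extensional Z"
      using formal by (simp add: formal_monad_Cbar_iff)
    from extensional_arb[OF this False] False show ?thesis
      by (simp add: formal_of_local_def)
  next
    case u: True
    let ?R = "restr_monad C L u"
    have F: "is_functor (restr_cat C u) (restr_cat C u) (endo ?R)"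
      using u by (simp add: L.is_functor_restr_monad)
    have "is_monad (restr_cat C u) ?R"
      using u by (simp add: L.is_monad_restr_monad)
    note ext = is_monadD(2,3)[OF this, unfolded restr_cat_simps(1)]
    note ext' = is_monadD(2,3)[OF fibre_monad[OF u], unfolded restr_cat_simps(1)]
    have "?R = M u"
    proof (rule monad.equality)
      show "endo ?R = endo (M u)"
      proof (rule cfunctor.equality)
        show "on_ob (endo ?R) = on_ob (endo (M u))"
          using is_functorD(1)[OF F] is_functorD(1)[OF fibre_functor[OF u]]
          by (rule extensionalityI) (simp add: L.restr_monad_simps on_ob_fibre[OF u])
        show "on_ar (endo ?R) = on_ar (endo (M u))"
          using is_functorD(2)[OF F] is_functorD(2)[OF fibre_functor[OF u]]
        proof (rule extensionalityI)
          fix x assume "x \<in> Ar (restr_cat C u)"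
          then show "on_ar (endo ?R) x = on_ar (endo (M u)) x"
            using u by (cases x) (simp add: L.restr_monad_simps on_ar_fibre st_local_of_formal)
        qed
      qed simp
      show "eta ?R = eta (M u)"
        using ext(1) ext'(1) by (rule extensionalityI) (use u in \<open>simp add: L.restr_monad_simps eta_mu_fibre\<close>)
      show "mu ?R = mu (M u)"
        using ext(2) ext'(2) by (rule extensionalityI) (use u in \<open>simp add: L.restr_monad_simps eta_mu_fibre\<close>)
    qed simp
    with u show ?thesis
      by (simp add: formal_of_local_def)
  qed
qed

end

section \<open>The round trip starting from a localisable monad\<close>

context localised_monad
begin

text \<open>The endofunctor, unit and multiplication return because \<open>restr_ar\<close> at the
  top is undone by \<open>from_top\<close>. The strength is compared first on \<open>Z\<close> and
  then at every central idempotent.\<close>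

lemma local_of_formal_of_local:
  assumes Z: "is_ZI C Z"
  shows "local_of_formal C Z (formal_of_local C Z L) = L"
proof -
  let ?M = "formal_of_local C Z L"
  interpret F: formal_monad_on C Z ?M
    using Z formal_of_local[of Z]
    by (intro formal_monad_on.intro formal_monad_on_axioms.intro stiff_category_axioms) (auto simp: is_ZI_def)
  have M: "?M u = restr_monad C L u" if "u \<in> Z" for u
    using that by (simp add: formal_of_local_def)
  have T: "F.T A = T A" if "A \<in> Ob C" for A
    using that by (simp add: M restr_monad_simps)
  have Ta: "F.Ta f = Ta f" if "f \<in> Ar C" for f
    using that by (simp add: F.Ta_conv M restr_monad_restr_ar del: F.Ta_ar)
  have endo: "top_functor C ?M = endo L"
  proof (rule cfunctor.equality)
    show "on_ob (top_functor C ?M) = on_ob (endo L)"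
      using is_functorD(1)[OF F.is_functor_top_functor] is_functorD(1)[OF endo_functor]
      by (rule extensionalityI) (simp add: T)
    show "on_ar (top_functor C ?M) = on_ar (endo L)"
      using is_functorD(2)[OF F.is_functor_top_functor] is_functorD(2)[OF endo_functor] Ta
      by (rule extensionalityI)
  qed simp
  have eta_mu: "F.eta_top A = eta L A" "F.mu_top A = mu L A" if "A \<in> Ob C" for A
    using that by (simp_all add: F.eta_top_def F.mu_top_def M restr_monad_simps del: F.eta_mu_top)
  \<comment> \<open>By \<open>F.str(4)\<close> the left side is the image of the adjunction unit
    under \<open>T|_u\<close>, which is \<open>Ta\<close> of an identity after
    \<open>st L A u\<close>.\<close>
  have str: "F.str A u = st L A u" if "A \<in> Ob C" "u \<in> Z" for A u
    using F.str(4)[OF that] that by (simp add: M restr_monad_simps)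
  have st: "st F.L A u = st L A u" if A: "A \<in> Ob C" and u: "u \<in> central_idempotents C" for A u
  proof -
    obtain z m where z: "z \<in> Z" and m: "is_iso C m" "m \<in> Ar C" "Dom C m = Dom C u" "Cod C m = Dom C z" "z \<cdot> m = u"
      and "F.Ta (idn C A \<boxtimes> m) \<cdot> st F.L A u = F.str A z \<cdot> (idn C (F.T A) \<boxtimes> m)"
      using F.st_local_of_formalE[OF u] A by metis
    then have "Ta (idn C A \<boxtimes> m) \<cdot> st F.L A u = st L A z \<cdot> (idn C (T A) \<boxtimes> m)"
      using A z m(1-4) by (simp add: str T Ta)
    \<comment> \<open>The given strength obeys the same transport law along \<open>m\<close>, by
      \<open>st_idem\<close>, so its values on \<open>Z\<close> determine it everywhere.\<close>
    also have "\<dots> = Ta (idn C A \<boxtimes> m) \<cdot> st L A u"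
      by (rule st_idem[OF A u _ _ m(5)[symmetric]]) (use z m(2-4) in \<open>simp_all add: hom_def\<close>)
    finally show ?thesis
      by (rule iso_monic[rotated -1])
        (use A u z m(1-4) in \<open>simp_all add: T functor_is_iso[OF endo_functor]\<close>)
  qed
  interpret FL: localised_monad C F.L
    by (rule F.localised_monad_local_of_formal)
  show ?thesis
  proof (rule lmonad.equality)
    show "endo F.L = endo L"
      by (simp add: endo)
    show "eta F.L = eta L"
      using is_monadD(2)[OF FL.is_monad] is_monadD(2)[OF is_monad]
      by (rule extensionalityI) (simp add: eta_mu)
    show "mu F.L = mu L"
      using is_monadD(3)[OF FL.is_monad] is_monadD(3)[OF is_monad]
      by (rule extensionalityI) (simp add: eta_mu)
    show "st F.L = st L"
      using FL.st_extensional(1) st_extensional(1)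
    proof (rule extensionalityI)
      fix A assume A: "A \<in> Ob C"
      show "st F.L A = st L A"
        using FL.st_extensional(2)[OF A] st_extensional(2)[OF A] st[OF A] by (rule extensionalityI)
    qed
  qed simp
qed

end

theorem theorem4p6:
  fixes C :: "('o, 'a) smc" and Z :: "'a set"
  assumes "stiff_category C" and "is_ZI C Z"
  shows "bij_betw (formal_of_local C Z) {L. localisable_monad C L} {M. formal_monad (Cbar C Z) M}
    \<and> bij_betw (local_of_formal C Z) {M. formal_monad (Cbar C Z) M} {L. localisable_monad C L}
    \<and> (\<forall>L. localisable_monad C L \<longrightarrow> local_of_formal C Z (formal_of_local C Z L) = L)
    \<and> (\<forall>M. formal_monad (Cbar C Z) M \<longrightarrow> formal_of_local C Z (local_of_formal C Z M) = M)
    \<and> (\<forall>M. formal_monad (Cbar C Z) M \<longrightarrow>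
         (\<forall>A\<in>Ob C. \<forall>u\<in>Z. st (local_of_formal C Z M) A u = formal_strength C M A u))"
proof -
  have local: "localised_monad C L" if "localisable_monad C L" for L
    using that localised_monad_iff[OF assms(1)] by blast
  have formal: "formal_monad_on C Z M" if "formal_monad (Cbar C Z) M" for M
    using assms that by (intro formal_monad_on.intro formal_monad_on_axioms.intro)
  have to_formal: "formal_monad (Cbar C Z) (formal_of_local C Z L)" if "localisable_monad C L" for L
    using assms(2) by (intro localised_monad.formal_of_local[OF local[OF that]]) (simp add: is_ZI_def)
  have to_local: "localisable_monad C (local_of_formal C Z M)" if "formal_monad (Cbar C Z) M" for M
    using formal_monad_on.localised_monad_local_of_formal[OF formal[OF that]] localised_monad_iff[OF assms(1)]
    by blast
  have left_inv: "local_of_formal C Z (formal_of_local C Z L) = L" if "localisable_monad C L" for L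
    by (rule localised_monad.local_of_formal_of_local[OF local[OF that] assms(2)])
  have right_inv: "formal_of_local C Z (local_of_formal C Z M) = M" if "formal_monad (Cbar C Z) M" for M
    by (rule formal_monad_on.formal_of_local_of_formal[OF formal[OF that]])
  have "bij_betw (formal_of_local C Z) {L. localisable_monad C L} {M. formal_monad (Cbar C Z) M}"
    by (rule bij_betw_byWitness[where f' = "local_of_formal C Z"]) (auto simp: to_formal to_local left_inv right_inv)
  moreover have "bij_betw (local_of_formal C Z) {M. formal_monad (Cbar C Z) M} {L. localisable_monad C L}"
    by (rule bij_betw_byWitness[where f' = "formal_of_local C Z"]) (auto simp: to_formal to_local left_inv right_inv)
  ultimately show ?thesis
    using left_inv right_inv formal_monad_on.st_local_of_formal[OF formal] by blast
qed

end
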